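(* For every integer $n\ge 3$, the Hermitian polar space $\mathsf{H}(2n-1,4)$ has no ovoid.
   Context: $\mathsf{H}(2n-1,4)$ denotes the finite classical polar space of totally isotropic subspaces of a non-degenerate Hermitian form on $V(2n,4)$ (with respect to the involution $x\mapsto x^2$ of $\mathrm{GF}(4)$), viewed in $\mathrm{PG}(2n-1,4)$; it has rank $n$, and its generators are the totally isotropic subspaces of projective dimension $n-1$. An ovoid of a finite polar space is a set $\mathcal{O}$ of points of the polar space such that every generator meets $\mathcal{O}$ in exactly one point. *)

theory Defs
  imports "HOL-Analysis.Cartesian_Space"
begin

text \<open>The form is linear in its first argument and \<open>\<sigma>\<close>-semilinear in its second;
  \<open>\<sigma>\<close> is meant to be an involutory automorphism of the ground field.\<close>

definition hermitian_form :: "('a \<Rightarrow> 'a) \<Rightarrow> ('a::field ^ 'm \<Rightarrow> 'a ^ 'm \<Rightarrow> 'a) \<Rightarrow> bool" where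
  "hermitian_form \<sigma> h \<longleftrightarrow>
     (\<forall>x y z. h (x + y) z = h x z + h y z) \<and>
     (\<forall>x y z. h x (y + z) = h x y + h x z) \<and>
     (\<forall>c x y. h (c *s x) y = c * h x y) \<and>
     (\<forall>c x y. h x (c *s y) = \<sigma> c * h x y) \<and>
     (\<forall>x y. h y x = \<sigma> (h x y))"

definition nondegenerate :: "('a::field ^ 'm \<Rightarrow> 'a ^ 'm \<Rightarrow> 'a) \<Rightarrow> bool" where
  "nondegenerate h \<longleftrightarrow> (\<forall>x. (\<forall>y. h x y = 0) \<longrightarrow> x = 0)"

definition totally_isotropic :: "('a::field ^ 'm \<Rightarrow> 'a ^ 'm \<Rightarrow> 'a) \<Rightarrow> ('a ^ 'm) set \<Rightarrow> bool" where
  "totally_isotropic h U \<longleftrightarrow> vec.subspace U \<and> (\<forall>x\<in>U. \<forall>y\<in>U. h x y = 0)"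

text \<open>Subspaces of the projective space are represented by the nonzero linear subspaces of the
  underlying vector space, so projective dimension is \<open>vec.dim\<close> minus one.\<close>

definition polar_space :: "('a::field ^ 'm \<Rightarrow> 'a ^ 'm \<Rightarrow> 'a) \<Rightarrow> ('a ^ 'm) set set" where
  "polar_space h = {U. totally_isotropic h U \<and> U \<noteq> {0}}"

definition points :: "('a::field ^ 'm) set set \<Rightarrow> ('a ^ 'm) set set" where
  "points S = {P \<in> S. vec.dim P = 1}"

text \<open>The parameter \<open>n\<close> is the rank of the polar space.\<close>

definition generators :: "nat \<Rightarrow> ('a::field ^ 'm) set set \<Rightarrow> ('a ^ 'm) set set" where
  "generators n S = {G \<in> S. vec.dim G = n}"

definition ovoid :: "nat \<Rightarrow> ('a::field ^ 'm) set set \<Rightarrow> ('a ^ 'm) set set \<Rightarrow> bool" where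
  "ovoid n S \<O> \<longleftrightarrow> \<O> \<subseteq> points S \<and> (\<forall>G \<in> generators n S. \<exists>!P. P \<in> \<O> \<and> P \<subseteq> G)"

end

theory Submission
  imports Defs
begin

text \<open>A hyperbolic basis reduces the problem to rank three, where counting gives an ovoid \<open>R\<close> of 33
  pairwise non-orthogonal points, nine of them in \<open>p\<^sup>\<bottom>\<close> for each isotropic point \<open>p \<notin> R\<close>. Every
  vector \<open>x\<close> gives a hermitian form \<open>v \<mapsto> N(h(v,x))\<close>, and for an isotropic point \<open>p\<close> the form
  \<open>\<kappa>\<^sub>p = N(h(\<cdot>,p)) + \<Sum>\<^bsub>x \<in> R \<inter> p\<^sup>\<bottom>\<^esub> N(h(\<cdot>,x))\<close>
  vanishes on \<open>R\<close> and on the isotropic points of \<open>p\<^sup>\<bottom>\<close>; the latter forces it to agree on \<open>p\<^sup>\<bottom>\<close> with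
  \<open>0\<close> or \<open>h\<close>. If \<open>p \<noteq> r\<close> are orthogonal and \<open>\<kappa>\<^sub>p\<close>, \<open>\<kappa>\<^sub>r\<close> are congruent but nonzero modulo \<open>h\<close>, then
  \<open>R\<close> lies in three tangent hyperplanes and \<open>33 \<le> 27\<close>. Over a totally isotropic line the \<open>\<kappa>\<^sub>p\<close> sum to
  \<open>0\<close> modulo \<open>h\<close>, so a line with one \<open>\<kappa>\<^sub>p\<close> nonzero modulo \<open>h\<close> has at least three, and a plane then has at
  least nine, which are pairwise incongruent. But there are only \<open>2\<^sup>3\<^sup>6\<close> hermitian forms, and the \<open>2\<^sup>3\<^sup>2\<close> sums
  of forms \<open>N(h(\<cdot>,x))\<close> over subsets of \<open>R\<close> without a fixed point are distinguished by their values on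
  \<open>R\<close>, so at most \<open>2\<^sup>4 < 9 \<cdot> 2\<close> forms vanish on \<open>R\<close>. Conversely at least four trace-zero
  forms vanish on \<open>R\<close>, so that not every \<open>\<kappa>\<^sub>p\<close> can be zero modulo \<open>h\<close>.\<close>

subsection \<open>Hermitian forms over the field with four elements\<close>

text \<open>Multiplication by \<open>a\<close> permutes the nonzero elements; compare their product
  before and after.\<close>

lemma f4_cube:
  fixes a :: "'a::{field,finite}"
  assumes "CARD('a) = 4" "a \<noteq> 0"
  shows "a ^ 3 = 1"
proof -
  have inj: "inj_on ((*) a) (UNIV - {0})"
    using assms by (auto simp: inj_on_def)
  have im: "(*) a ` (UNIV - {0}) = UNIV - {0}"
    by (rule endo_inj_surj) (use assms inj in auto)
  have "\<Prod>(UNIV - {0::'a}) = (\<Prod>x\<in>UNIV - {0}. a * x)"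
    using prod.reindex[OF inj, of "\<lambda>x. x"] im by (simp add: o_def)
  also have "\<dots> = a ^ 3 * \<Prod>(UNIV - {0})"
    using assms by (simp add: prod.distrib card_Diff_singleton)
  finally show ?thesis by simp
qed

lemma f4_add_self:
  fixes a :: "'a::{field,finite}"
  assumes "CARD('a) = 4"
  shows "a + a = 0"
proof -
  have "(-1 :: 'a) ^ 3 = 1" using f4_cube[OF assms, of "-1"] by simp
  hence "1 + 1 = (0::'a)" by (simp add: power3_eq_cube eq_neg_iff_add_eq_0)
  thus ?thesis by (metis distrib_right mult_1 mult_zero_left)
qed

lemma f4_minus:
  fixes a b :: "'a::{field,finite}"
  assumes "CARD('a) = 4"
  shows "- a = a" "a - b = a + b"
proof -
  have m: "- b = b" for b :: 'a
    using f4_add_self[OF assms, of b] by (simp add: minus_unique)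
  show "- a = a" "a - b = a + b" using m[of a] m[of b] by (auto simp: diff_conv_add_uminus simp del: add_uminus_conv_diff)
qed

text \<open>Any element outside \<open>{0, 1}\<close> is a root of the quadratic factor of
  \<open>w ^ 3 - 1\<close>.\<close>

lemma f4_omega:
  assumes "CARD('a::{field,finite}) = 4"
  obtains w :: "'a::{field,finite}" where "w \<noteq> 0" "w \<noteq> 1" "w * w = w + 1" "UNIV = {0, 1, w, w + 1}"
    "distinct [0, 1, w, w + 1]"
proof -
  have "(UNIV :: 'a set) \<noteq> {0, 1}"
  proof
    assume "(UNIV :: 'a set) = {0, 1}"
    hence "CARD('a) = card {0, 1::'a}" by simp
    thus False using assms by simp
  qed
  then obtain w :: 'a where w: "w \<noteq> 0" "w \<noteq> 1" by blast
  have "(w - 1) * (w * w + w + 1) = 0"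
    using f4_cube[OF assms w(1)] by (simp add: algebra_simps power3_eq_cube)
  hence "w * w + w + 1 = 0" using w by simp
  hence "w * w = - (w + 1)" by (simp only: eq_neg_iff_add_eq_0 add.assoc)
  hence ww: "w * w = w + 1" by (simp only: f4_minus(1)[OF assms])
  have "w + 1 \<noteq> 0"
  proof
    assume "w + 1 = 0"
    hence "w = - 1" by (simp only: eq_neg_iff_add_eq_0)
    thus False using w by (simp only: f4_minus(1)[OF assms])
  qed
  with w have d: "distinct [0, 1, w, w + 1]" by auto
  have "card {0, 1, w, w + 1} = 4" using distinct_card[OF d] by simp
  hence "UNIV = {0, 1, w, w + 1}"
    using assms by (metis card_subset_eq finite subset_UNIV)
  with w ww d show ?thesis using that by blast
qed

lemma f4_square_add:
  fixes a b :: "'a::{field,finite}"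
  assumes "CARD('a) = 4"
  shows "(a + b)\<^sup>2 = a\<^sup>2 + b\<^sup>2"
proof -
  have "(a + b)\<^sup>2 = a\<^sup>2 + b\<^sup>2 + (a * b + a * b)" by (simp add: power2_eq_square algebra_simps)
  thus ?thesis by (simp only: f4_add_self[OF assms]) simp
qed

lemma f4_square_square:
  fixes a :: "'a::{field,finite}"
  assumes "CARD('a) = 4"
  shows "(a\<^sup>2)\<^sup>2 = a"
  using f4_cube[OF assms, of a] by (cases "a = 0") (auto simp: power2_eq_square power3_eq_cube mult.assoc)

section \<open>Nondegenerate hermitian spaces of even dimension over GF(4)\<close>

locale hermitian_space =
  fixes n :: nat and h :: "'a::{field,finite} ^ 'm::finite \<Rightarrow> 'a ^ 'm \<Rightarrow> 'a"
  assumes q4: "CARD('a) = 4" and dim_eq: "CARD('m) = 2 * n"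
    and herm: "hermitian_form (\<lambda>x. x ^ 2) h" and nondeg: "nondegenerate h"
begin

lemmas add_self [simp] = f4_add_self[OF q4]
lemmas minus_eq [simp] = f4_minus[OF q4]
lemmas square_add [simp] = f4_square_add[OF q4]
lemmas square_square [simp] = f4_square_square[OF q4]

lemma numeral_char_2 [simp]:
  "numeral (num.Bit0 k) = (0::'a)" "numeral (num.Bit1 k) = (1::'a)"
  by (simp_all only: numeral_Bit0 numeral_Bit1 add_self add_0)

lemma add_self2 [simp]: "(a::'a) + (a + b) = b"
  by (metis add.assoc add_self add_0)

lemma power4 [simp]: "(a::'a) ^ 4 = a"
  using square_square[of a] by (simp del: square_square)

lemma trace_zero_iff: "(a::'a) + a\<^sup>2 = 0 \<longleftrightarrow> a = 0 \<or> a = 1"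
proof -
  have "a + a\<^sup>2 = a * (a - 1)" by (simp only: power2_eq_square minus_eq) (simp add: algebra_simps)
  thus ?thesis by (simp del: minus_eq)
qed

text \<open>The left side is the trace of \<open>a * c\<^sup>2\<close> down to GF(2), and the trace
  is not identically zero.\<close>

lemma trace_form_nondeg:
  assumes "\<And>c. (a::'a) * c\<^sup>2 + a\<^sup>2 * c = 0"
  shows "a = 0"
proof (rule ccontr)
  assume a: "a \<noteq> 0"
  obtain w :: 'a where w: "w \<noteq> 0" "w \<noteq> 1" "w * w = w + 1" using f4_omega[OF q4] by blast
  \<comment> \<open>For \<open>c = a * w\<close> the expression is
    \<open>a ^ 3 * (w\<^sup>2 + w)\<close>, which equals 1.\<close>
  from assms[of "a * w"] f4_cube[OF q4 a] w show False
    by (simp add: power2_eq_square power3_eq_cube algebra_simps)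
qed

lemma hermD:
  fixes B :: "'a ^ 'm \<Rightarrow> 'a ^ 'm \<Rightarrow> 'a"
  assumes "hermitian_form (\<lambda>x. x ^ 2) B"
  shows "B (x + y) z = B x z + B y z" "B x (y + z) = B x y + B x z"
    "B (c *s x) y = c * B x y" "B x (c *s y) = c\<^sup>2 * B x y" "B y x = (B x y)\<^sup>2"
    "B 0 y = 0" "B x 0 = 0"
proof -
  show *: "B (x + y) z = B x z + B y z" "B x (y + z) = B x y + B x z"
    "B (c *s x) y = c * B x y" "B x (c *s y) = c\<^sup>2 * B x y" "B y x = (B x y)\<^sup>2" for x y z c
    using assms unfolding hermitian_form_def by blast+
  show "B 0 y = 0" "B x 0 = 0" using *(3)[of 0 0 y] *(4)[of x 0 0] by simp_all
qed

lemmas h_simps [simp] = hermD(1-4,6,7)[OF herm]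
lemmas h_sym = hermD(5)[OF herm]

lemma vminus [simp]: "(x::'a^'m) - y = x + y" "- x = x" "x + x = 0" "x + (x + y) = y"
  by (simp_all add: vec_eq_iff del: minus_add_cancel)

lemma vadd_eq_0_iff [simp]: "(x::'a^'m) + y = 0 \<longleftrightarrow> x = y"
  using right_minus_eq[of x y] by (simp del: right_minus_eq)

lemma herm_sum:
  fixes B :: "'a ^ 'm \<Rightarrow> 'a ^ 'm \<Rightarrow> 'a"
  assumes "hermitian_form (\<lambda>x. x ^ 2) B"
  shows "B (\<Sum>i\<in>I. g i) y = (\<Sum>i\<in>I. B (g i) y)" "B y (\<Sum>i\<in>I. g i) = (\<Sum>i\<in>I. B y (g i))"
  by (induction I rule: infinite_finite_induct) (simp_all add: hermD(1-4,6,7)[OF assms])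

lemma h_zero_sym: "h x y = 0 \<longleftrightarrow> h y x = 0"
  using h_sym[of x y] h_sym[of y x] by auto

lemma h_self: "h x x = 0 \<or> h x x = 1"
proof -
  have "h x x + (h x x)\<^sup>2 = 0" by (simp only: h_sym[of x x, symmetric] add_self)
  thus ?thesis by (simp add: trace_zero_iff)
qed

text \<open>Expanding \<open>B\<close> on \<open>v + c *s w\<close> leaves only the trace of
  \<open>B v w * c\<^sup>2\<close>, for every \<open>c\<close>.\<close>

lemma polarize:
  fixes B :: "'a ^ 'm \<Rightarrow> 'a ^ 'm \<Rightarrow> 'a"
  assumes B: "hermitian_form (\<lambda>x. x ^ 2) B" and "vec.subspace W"
    and z: "\<And>v. v \<in> W \<Longrightarrow> B v v = 0" and vw: "v \<in> W" "w \<in> W"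
  shows "B v w = 0"
proof (rule trace_form_nondeg)
  fix c
  have "v + c *s w \<in> W" using assms by (simp add: vec.subspace_add vec.subspace_scale)
  from z[OF this] z[OF vw(1)] z[OF vw(2)] show "B v w * c\<^sup>2 + (B v w)\<^sup>2 * c = 0"
    by (simp add: hermD(1-4)[OF B] hermD(5)[OF B, of w v] algebra_simps)
qed

subsection \<open>Hyperbolic bases\<close>

text \<open>These are \<open>k\<close> mutually orthogonal hyperbolic pairs, possibly only part of a
  basis; values at indices from \<open>k\<close> on are irrelevant, so that families can be extended
  by function update.\<close>

definition hyperbolic :: "nat \<Rightarrow> (nat \<Rightarrow> 'a^'m) \<Rightarrow> (nat \<Rightarrow> 'a^'m) \<Rightarrow> bool" where
  "hyperbolic k e f \<longleftrightarrow> (\<forall>i<k. \<forall>j<k. h (e i) (e j) = 0 \<and> h (f i) (f j) = 0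
     \<and> h (e i) (f j) = (if i = j then 1 else 0))"

lemma hyperbolicD:
  assumes "hyperbolic k e f" "i < k" "j < k"
  shows "h (e i) (e j) = 0" "h (f i) (f j) = 0" "h (e i) (f j) = (if i = j then 1 else 0)"
    "h (f i) (e j) = (if i = j then 1 else 0)"
  using assms h_sym[of "f i" "e j"] unfolding hyperbolic_def by auto

lemma independent_dual:
  assumes "\<And>s. s \<in> S \<Longrightarrow> \<exists>d. h s d \<noteq> 0 \<and> (\<forall>t\<in>S - {s}. h t d = 0)"
  shows "vec.independent S"
  unfolding vec.dependent_def
proof safe
  fix s assume s: "s \<in> S" "s \<in> vec.span (S - {s})"
  obtain d where d: "h s d \<noteq> 0" "\<forall>t\<in>S - {s}. h t d = 0" using assms s by blast
  have "vec.subspace {v. h v d = 0}" by (auto simp: vec.subspace_def)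
  hence "vec.span (S - {s}) \<subseteq> {v. h v d = 0}"
    using d by (intro vec.span_minimal) auto
  thus False using s d by auto
qed

lemma hyperbolic_independent:
  assumes "hyperbolic k e f"
  shows "vec.independent (e ` {..<k} \<union> f ` {..<k})" "card (e ` {..<k} \<union> f ` {..<k}) = 2 * k"
    "vec.independent (e ` {..<k})" "card (e ` {..<k}) = k"
proof -
  note H = hyperbolicD[OF assms]
  show ind: "vec.independent (e ` {..<k} \<union> f ` {..<k})"
  proof (rule independent_dual)
    fix s assume "s \<in> e ` {..<k} \<union> f ` {..<k}"
    then consider i where "i < k" "s = e i" | i where "i < k" "s = f i" by auto
    thus "\<exists>d. h s d \<noteq> 0 \<and> (\<forall>t\<in>(e ` {..<k} \<union> f ` {..<k}) - {s}. h t d = 0)"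
    proof cases
      case 1 thus ?thesis by (intro exI[of _ "f i"]) (auto simp: H split: if_splits)
    next
      case 2 thus ?thesis by (intro exI[of _ "e i"]) (auto simp: H split: if_splits)
    qed
  qed
  have "inj_on e {..<k}" "inj_on f {..<k}"
    by (auto simp: inj_on_def) (metis H(3,4) zero_neq_one)+
  moreover have "e ` {..<k} \<inter> f ` {..<k} = {}"
    by auto (metis H(1,4) zero_neq_one)
  ultimately show "card (e ` {..<k} \<union> f ` {..<k}) = 2 * k" "card (e ` {..<k}) = k"
    by (simp_all add: card_Un_disjoint card_image)
  show "vec.independent (e ` {..<k})" using ind vec.independent_mono by blast
qed

text \<open>Projection onto the orthogonal complement of the \<open>k\<close> hyperbolic pairs;
  characteristic two turns the usual minus sign into plus.\<close>

definition hproj :: "nat \<Rightarrow> (nat \<Rightarrow> 'a^'m) \<Rightarrow> (nat \<Rightarrow> 'a^'m) \<Rightarrow> 'a^'m \<Rightarrow> 'a^'m" where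
  "hproj k e f v = v + (\<Sum>i<k. h v (f i) *s e i + h v (e i) *s f i)"

lemma h_hproj:
  assumes "hyperbolic k e f" "j < k"
  shows "h (hproj k e f v) (e j) = 0" "h (hproj k e f v) (f j) = 0"
    "h (e j) (hproj k e f v) = 0" "h (f j) (hproj k e f v) = 0"
proof -
  note H = hyperbolicD[OF assms(1) _ assms(2)]
  have delta: "a * (if i = j then 1 else 0) = (if i = j then a else 0)" for a :: 'a and i
    by simp
  show *: "h (hproj k e f v) (e j) = 0" "h (hproj k e f v) (f j) = 0"
    using assms by (simp_all add: hproj_def herm_sum[OF herm] H delta sum.delta cong: sum.cong_simp)
  show "h (e j) (hproj k e f v) = 0" "h (f j) (hproj k e f v) = 0"
    using * h_zero_sym by blast+
qed

lemma h_hproj_perp: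
  assumes "\<And>i. i < k \<Longrightarrow> h p (e i) = 0 \<and> h p (f i) = 0"
  shows "h p (hproj k e f v) = h p v" "h (hproj k e f v) p = h v p"
proof -
  show "h p (hproj k e f v) = h p v"
    using assms by (simp add: hproj_def herm_sum[OF herm])
  thus "h (hproj k e f v) p = h v p" by (metis h_sym)
qed

lemma not_span_ex:
  assumes "card (S :: ('a^'m) set) < 2 * n"
  shows "\<exists>v. v \<notin> vec.span S"
proof (rule ccontr)
  assume "\<not> ?thesis"
  hence "vec.dim (UNIV :: ('a^'m) set) \<le> card S"
    by (intro vec.dim_le_card) auto
  thus False using assms dim_eq by (simp only: vec_dim_card)
qed

lemma hyperbolic_expand:
  assumes "hyperbolic n e f"
  shows "v = (\<Sum>i<n. h v (f i) *s e i + h v (e i) *s f i)"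
proof -
  let ?S = "e ` {..<n} \<union> f ` {..<n}"
  note H = hyperbolic_independent[OF assms]
  have "vec.dim (UNIV :: ('a^'m) set) = 2 * n" using dim_eq by (simp only: vec_dim_card)
  hence "UNIV \<subseteq> vec.span ?S"
    using H by (intro vec.card_ge_dim_independent) auto
  hence span: "vec.span ?S = UNIV" by auto
  have "h (hproj n e f v) x = 0" for x
  proof -
    have "vec.subspace {x. h (hproj n e f v) x = 0}" by (auto simp: vec.subspace_def)
    hence "vec.span ?S \<subseteq> {x. h (hproj n e f v) x = 0}"
      using h_hproj[OF assms] by (intro vec.span_minimal) auto
    thus ?thesis using span by auto
  qed
  hence "hproj n e f v = 0" using nondeg by (auto simp: nondegenerate_def)
  thus ?thesis by (simp add: hproj_def)
qed

text \<open>The complement of the \<open>k\<close> pairs has dimension at least two. If two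
  orthogonal vectors found there are both anisotropic, each has norm 1, and their sum has norm
  \<open>1 + 1 = 0\<close>.\<close>

lemma isotropic_perp_ex:
  assumes H: "hyperbolic k e f" and "k < n"
  shows "\<exists>p. p \<noteq> 0 \<and> h p p = 0 \<and> (\<forall>i<k. h p (e i) = 0 \<and> h p (f i) = 0)"
proof -
  let ?S = "e ` {..<k} \<union> f ` {..<k}"
  have inS: "(\<Sum>i<k. a i *s e i + b i *s f i) \<in> vec.span ?S" for a b
    by (intro vec.span_sum vec.span_add vec.span_scale vec.span_base) auto
  have cS: "card ?S = 2 * k" using hyperbolic_independent(2)[OF H] .
  obtain v where v: "v \<notin> vec.span ?S" using not_span_ex[of ?S] cS assms by auto
  define w where "w = hproj k e f v"
  have w0: "w \<noteq> 0"
  proof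
    assume "w = 0"
    hence "v = (\<Sum>i<k. h v (f i) *s e i + h v (e i) *s f i)" by (simp add: w_def hproj_def)
    with v inS[of "\<lambda>i. h v (f i)" "\<lambda>i. h v (e i)"] show False by simp
  qed
  have wp: "h w (e i) = 0 \<and> h w (f i) = 0" if "i < k" for i using h_hproj[OF H that] by (simp add: w_def)
  show ?thesis
  proof (cases "h w w = 0")
    case True thus ?thesis using w0 wp by blast
  next
    case False
    hence w1: "h w w = 1" using h_self by blast
    have "card (insert w ?S) < 2 * n"
      using cS assms card_insert_le_m1[of "2 * k + 1" ?S w] by linarith
    then obtain u where u: "u \<notin> vec.span (insert w ?S)" using not_span_ex by blast
    define x where "x = hproj k e f u + h u w *s w"
    have "x \<noteq> 0"
    proof
      assume "x = 0"
      hence "u = (\<Sum>i<k. h u (f i) *s e i + h u (e i) *s f i) + h u w *s w"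
        by (simp add: x_def hproj_def add.assoc)
      moreover have "\<dots> \<in> vec.span (insert w ?S)"
        using inS[of "\<lambda>i. h u (f i)" "\<lambda>i. h u (e i)"] vec.span_mono[OF subset_insertI[of ?S w]]
        by (intro vec.span_add vec.span_scale) (auto intro: vec.span_base)
      ultimately show False using u by simp
    qed
    have xp: "h x (e i) = 0 \<and> h x (f i) = 0" if "i < k" for i
      using h_hproj[OF H that] wp[OF that] by (simp add: x_def)
    have xw: "h x w = 0" using wp w1 by (simp add: x_def h_hproj_perp)
    hence wx: "h w x = 0" using h_zero_sym by blast
    show ?thesis
    proof (cases "h x x = 0")
      case True thus ?thesis using \<open>x \<noteq> 0\<close> xp by blast
    next
      case False
      hence "h x x = 1" using h_self by blast
      hence "h (w + x) (w + x) = 0" using w1 xw wx by simp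
      moreover have "w + x \<noteq> 0"
      proof
        assume "w + x = 0"
        hence "h (w + x) w = 0" by simp
        thus False using w1 xw by simp
      qed
      ultimately show ?thesis using wp xp by (intro exI[of _ "w + x"]) auto
    qed
  qed
qed

text \<open>Nondegeneracy supplies a vector not orthogonal to \<open>p\<close>; it is projected,
  scaled and made isotropic to become the partner of \<open>p\<close>.\<close>

lemma hyperbolic_extend:
  assumes H: "hyperbolic k e f" and p: "p \<noteq> 0" "h p p = 0" "\<And>i. i < k \<Longrightarrow> h p (e i) = 0 \<and> h p (f i) = 0"
  shows "\<exists>q. hyperbolic (Suc k) (e(k := p)) (f(k := q))"
proof -
  obtain y where y: "h p y \<noteq> 0" using p nondeg unfolding nondegenerate_def by blast
  \<comment> \<open>The square in the scalar cancels the squaring in the second argument of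
    \<open>h\<close>, as \<open>(c\<^sup>2)\<^sup>2 = c\<close>.\<close>
  define z where "z = hproj k e f ((1 / h p y)\<^sup>2 *s y)"
  have pz: "h p z = 1" using y p(3) by (simp add: z_def h_hproj_perp)
  hence zp: "h z p = 1" using h_sym[of z p] by simp
  obtain w :: 'a where w: "w \<noteq> 0" "w \<noteq> 1" "w * w = w + 1" using f4_omega[OF q4] by blast
  \<comment> \<open>If \<open>h z z = 1\<close>, adding \<open>w *s p\<close> changes it by
    \<open>w + w\<^sup>2 = 1\<close>.\<close>
  define q where "q = (if h z z = 0 then z else z + w *s p)"
  have "h q q = 0" using h_self[of z] pz zp p(2) w by (auto simp: q_def power2_eq_square)
  moreover have pq: "h p q = 1" using pz p(2) by (auto simp: q_def)
  moreover have "h q p = 1" using h_sym[of q p] pq by simp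
  moreover have "h q (e i) = 0 \<and> h q (f i) = 0" if "i < k" for i
    using h_hproj[OF H that] p(3)[OF that] by (auto simp: q_def z_def)
  moreover from this have "h (e i) q = 0 \<and> h (f i) q = 0" if "i < k" for i
    using that h_zero_sym by blast
  moreover have "h (e i) p = 0 \<and> h (f i) p = 0" if "i < k" for i
    using that p(3) h_zero_sym by blast
  ultimately have "hyperbolic (Suc k) (e(k := p)) (f(k := q))"
    using H p unfolding hyperbolic_def by (auto simp: less_Suc_eq)
  thus ?thesis ..
qed

lemma hyperbolic_complete:
  assumes "hyperbolic k e f" "k \<le> n"
  shows "\<exists>e' f'. hyperbolic n e' f' \<and> (\<forall>i<k. e' i = e i \<and> f' i = f i)"
  using assms(2,1)
proof (induction k arbitrary: e f rule: inc_induct)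
  case base thus ?case by blast
next
  case (step k)
  obtain p where p: "p \<noteq> 0" "h p p = 0" "\<And>i. i < k \<Longrightarrow> h p (e i) = 0 \<and> h p (f i) = 0"
    using isotropic_perp_ex[OF step.prems step.hyps(2)] by blast
  obtain q where q: "hyperbolic (Suc k) (e(k := p)) (f(k := q))"
    using hyperbolic_extend[OF step.prems p] by blast
  from step.IH[OF q] obtain e' f' where
    "hyperbolic n e' f'" "\<forall>i<Suc k. e' i = (e(k := p)) i \<and> f' i = (f(k := q)) i" by blast
  thus ?case by (intro exI[of _ e'] exI[of _ f']) (auto simp: less_Suc_eq)
qed

lemma hyperbolic_point:
  assumes "p \<noteq> 0" "h p p = 0" "1 \<le> n"
  shows "\<exists>e f. hyperbolic n e f \<and> e 0 = p"
proof -
  have "hyperbolic 0 e f" for e f by (simp add: hyperbolic_def)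
  from hyperbolic_extend[OF this assms(1,2)]
  obtain e f where "hyperbolic 1 e f" "e 0 = p" by (metis One_nat_def fun_upd_same less_nat_zero_code)
  with hyperbolic_complete[of 1 e f] assms(3) show ?thesis by auto
qed

text \<open>First complete \<open>p\<close> to a pair, then replace \<open>r\<close> by a translate
  \<open>r'\<close> along \<open>p\<close> that is orthogonal to this pair, extend by
  \<open>r'\<close>, and finally change the basis back to \<open>r\<close>.\<close>

lemma hyperbolic_line:
  assumes "h p p = 0" "h r r = 0" "h p r = 0" "p \<noteq> 0" "\<And>c. r \<noteq> c *s p" "2 \<le> n"
  shows "\<exists>e f. hyperbolic n e f \<and> e 0 = p \<and> e 1 = r"
proof -
  have rp: "h r p = 0" using assms(3) h_zero_sym by blast
  have "hyperbolic 0 e f" for e f by (simp add: hyperbolic_def)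
  from hyperbolic_extend[OF this assms(4,1)]
  obtain e f where ef: "hyperbolic 1 e f" "e 0 = p" by (metis One_nat_def fun_upd_same less_nat_zero_code)
  define d where "d = h r (f 0)"
  have pf: "h p (f 0) = 1" "h (f 0) p = 1" "h (f 0) (f 0) = 0" using hyperbolicD[OF ef(1), of 0 0] ef(2) by auto
  have fr: "h (f 0) r = d\<^sup>2" unfolding d_def by (rule h_sym)
  define r' where "r' = r + d *s p"
  have r': "r' \<noteq> 0" "h r' r' = 0" "\<And>i. i < 1 \<Longrightarrow> h r' (e i) = 0 \<and> h r' (f i) = 0"
    using assms(5)[of d] assms rp ef(2) pf
    by (auto simp: r'_def d_def add_eq_0_iff)
  obtain q where q: "hyperbolic (Suc 1) (e(1 := r')) (f(1 := q))"
    using hyperbolic_extend[OF ef(1) r'] by blast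
  have pq: "h p q = 0" "h q p = 0" "h r' q = 1" "h q r' = 1" "h (f 0) q = 0" "h q (f 0) = 0" "h q q = 0"
    using hyperbolicD[OF q, of 0 1] hyperbolicD[OF q, of 1 0] hyperbolicD[OF q, of 1 1] ef(2) by auto
  have rq: "h r q = 1" "h q r = 1" using pq by (auto simp: r'_def)
  define e2 where "e2 = e(1 := r)"
  \<comment> \<open>The correction restores orthogonality: \<open>h r (f 0) = d\<close>, and
    \<open>d\<^sup>2 *s q\<close> contributes another \<open>d\<close>.\<close>
  define f2 where "f2 = f(0 := f 0 + d\<^sup>2 *s q, 1 := q)"
  have "hyperbolic (Suc (Suc 0)) e2 f2"
    unfolding hyperbolic_def e2_def f2_def
    using ef(2) pf pq rq assms rp fr by (auto simp: less_Suc_eq d_def[symmetric])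
  hence "hyperbolic 2 e2 f2" by (simp add: numeral_2_eq_2)
  with hyperbolic_complete[OF this assms(6)] ef(2) show ?thesis
    by (metis e2_def fun_upd_other fun_upd_same one_less_numeral_iff semiring_norm(76) zero_less_numeral zero_neq_one)
qed

text \<open>The span of half a hyperbolic basis is its own orthogonal complement, so membership in a
  generator becomes a set of linear equations.\<close>

lemma hyperbolic_span_iff:
  assumes H: "hyperbolic n e f"
  shows "v \<in> vec.span (e ` {..<n}) \<longleftrightarrow> (\<forall>i<n. h v (e i) = 0)"
proof
  assume v: "v \<in> vec.span (e ` {..<n})"
  show "\<forall>i<n. h v (e i) = 0"
  proof safe
    fix i assume i: "i < n"
    have "vec.subspace {v. h v (e i) = 0}" by (auto simp: vec.subspace_def)
    hence "vec.span (e ` {..<n}) \<subseteq> {v. h v (e i) = 0}"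
      using hyperbolicD[OF H _ i] by (intro vec.span_minimal) auto
    thus "h v (e i) = 0" using v by auto
  qed
next
  assume "\<forall>i<n. h v (e i) = 0"
  hence "v = (\<Sum>i<n. h v (f i) *s e i)"
    using hyperbolic_expand[OF H, of v] by (simp cong: sum.cong_simp)
  also have "\<dots> \<in> vec.span (e ` {..<n})"
    by (intro vec.span_sum vec.span_scale vec.span_base) auto
  finally show "v \<in> vec.span (e ` {..<n})" .
qed

lemma hyperbolic_generator:
  assumes H: "hyperbolic n e f" and "1 \<le> n"
  shows "vec.span (e ` {..<n}) \<in> generators n (polar_space h)"
proof -
  have d: "vec.dim (vec.span (e ` {..<n})) = n"
    using hyperbolic_independent[OF H] by (simp add: vec.dim_span vec.dim_eq_card_independent)
  have "h x y = 0" if x: "x \<in> vec.span (e ` {..<n})" and y: "y \<in> vec.span (e ` {..<n})" for x y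
  proof -
    have "vec.subspace {v. h x v = 0}" by (auto simp: vec.subspace_def)
    hence "vec.span (e ` {..<n}) \<subseteq> {v. h x v = 0}"
      using x unfolding hyperbolic_span_iff[OF H] by (intro vec.span_minimal) auto
    thus ?thesis using y by auto
  qed
  moreover have "e 0 \<in> vec.span (e ` {..<n})" "e 0 \<noteq> 0"
    using assms hyperbolicD(3)[OF H, of 0 0] by (auto intro!: vec.span_base)
  ultimately show ?thesis using d
    by (auto simp: generators_def polar_space_def totally_isotropic_def)
qed

end

subsection \<open>Intersection numbers of an ovoid of rank three\<close>

text \<open>The sets \<open>S c - {x0}\<close> partition \<open>A - {x0}\<close>. In the
  applications \<open>c\<close> runs over the four field elements.\<close>

lemma card_pencil:
  fixes S :: "'c::finite \<Rightarrow> 'b set"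
  assumes "finite A" "x0 \<in> A" "\<And>x. x \<in> A - {x0} \<Longrightarrow> \<exists>!c. x \<in> S c"
    "\<And>c. S c \<subseteq> A" "\<And>c. x0 \<in> S c" "\<And>c. card (S c) = Suc k"
  shows "card A = Suc (CARD('c) * k)"
proof -
  have eq: "A - {x0} = (\<Union>c. S c - {x0})"
  proof (intro equalityI subsetI)
    fix x assume "x \<in> A - {x0}"
    thus "x \<in> (\<Union>c. S c - {x0})" using assms(3)[of x] by auto
  qed (use assms(4) in auto)
  have fin: "finite (S c)" for c using assms(1,4) finite_subset by blast
  have "card (A - {x0}) = (\<Sum>c\<in>(UNIV::'c set). card (S c - {x0}))"
    unfolding eq
  proof (rule card_UN_disjoint)
    show "\<forall>i\<in>UNIV. \<forall>j\<in>UNIV. i \<noteq> j \<longrightarrow> (S i - {x0}) \<inter> (S j - {x0}) = {}"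
    proof safe
      fix i j x assume "i \<noteq> j" "x \<in> S i" "x \<in> S j" "x \<notin> {}"
      moreover from this have "x \<in> A" using assms(4) by blast
      ultimately show "x = x0" using assms(3)[of x] by (metis Diff_iff singletonD)
    qed
  qed (use fin in auto)
  also have "\<dots> = CARD('c) * k" using assms(5,6) fin by (simp add: card_Diff_singleton)
  finally show ?thesis using assms(1,2) by (metis card.remove)
qed

declare One_nat_def [simp del]

context hermitian_space
begin

lemma hyperbolic3I:
  assumes "h (e 0) (e 0) = 0" "h (e 1) (e 1) = 0" "h (e 2) (e 2) = 0"
    "h (e 0) (e 1) = 0" "h (e 0) (e 2) = 0" "h (e 1) (e 2) = 0"
    "h (f 0) (f 0) = 0" "h (f 1) (f 1) = 0" "h (f 2) (f 2) = 0"
    "h (f 0) (f 1) = 0" "h (f 0) (f 2) = 0" "h (f 1) (f 2) = 0"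
    "h (e 0) (f 0) = 1" "h (e 1) (f 1) = 1" "h (e 2) (f 2) = 1"
    "h (e 0) (f 1) = 0" "h (e 0) (f 2) = 0" "h (e 1) (f 0) = 0"
    "h (e 1) (f 2) = 0" "h (e 2) (f 0) = 0" "h (e 2) (f 1) = 0"
  shows "hyperbolic 3 e f"
proof -
  have s: "i < 3 \<longleftrightarrow> i = 0 \<or> i = 1 \<or> i = 2" for i :: nat by auto
  show ?thesis unfolding hyperbolic_def s
    using assms assms(4-6,10-12)[THEN h_zero_sym[THEN iffD1]] by auto
qed

lemma hyperbolic3D:
  assumes "hyperbolic 3 e f"
  shows "h (e 0) (e 0) = 0" "h (e 1) (e 1) = 0" "h (e 2) (e 2) = 0"
    "h (e 0) (e 1) = 0" "h (e 0) (e 2) = 0" "h (e 1) (e 2) = 0"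
    "h (e 1) (e 0) = 0" "h (e 2) (e 0) = 0" "h (e 2) (e 1) = 0"
    "h (f 0) (f 0) = 0" "h (f 1) (f 1) = 0" "h (f 2) (f 2) = 0"
    "h (f 0) (f 1) = 0" "h (f 0) (f 2) = 0" "h (f 1) (f 2) = 0"
    "h (f 1) (f 0) = 0" "h (f 2) (f 0) = 0" "h (f 2) (f 1) = 0"
    "h (e 0) (f 0) = 1" "h (e 1) (f 1) = 1" "h (e 2) (f 2) = 1"
    "h (f 0) (e 0) = 1" "h (f 1) (e 1) = 1" "h (f 2) (e 2) = 1"
    "h (e 0) (f 1) = 0" "h (e 0) (f 2) = 0" "h (e 1) (f 0) = 0"
    "h (e 1) (f 2) = 0" "h (e 2) (f 0) = 0" "h (e 2) (f 1) = 0"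
    "h (f 1) (e 0) = 0" "h (f 2) (e 0) = 0" "h (f 0) (e 1) = 0"
    "h (f 2) (e 1) = 0" "h (f 0) (e 2) = 0" "h (f 1) (e 2) = 0"
  using hyperbolicD[OF assms] by auto

end

text \<open>\<open>R\<close> holds one representative vector for each point of the ovoid. The ovoid
  condition is imposed on planes spanned by half a hyperbolic basis.\<close>

locale ovoid6 = hermitian_space 3 h
  for h :: "'a::{field,finite} ^ 'm::finite \<Rightarrow> 'a ^ 'm \<Rightarrow> 'a" +
  fixes R :: "('a ^ 'm) set"
  assumes R_isotropic: "x \<in> R \<Longrightarrow> x \<noteq> 0 \<and> h x x = 0"
    and R_plane: "hyperbolic 3 e f \<Longrightarrow> \<exists>!x. x \<in> R \<and> x \<in> vec.span (e ` {..<3})"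
begin

lemma ex_hyperbolic: "\<exists>e f. hyperbolic 3 e f"
  using hyperbolic_complete[of 0 "\<lambda>_. 0" "\<lambda>_. 0"] by (auto simp: hyperbolic_def)

lemma expand3:
  assumes "hyperbolic 3 e f"
  shows "v = h v (f 0) *s e 0 + h v (f 1) *s e 1 + h v (f 2) *s e 2
    + h v (e 0) *s f 0 + h v (e 1) *s f 1 + h v (e 2) *s f 2"
  using hyperbolic_expand[OF assms, of v] by (simp add: numeral_3_eq_3 numeral_2_eq_2 One_nat_def ac_simps)

lemma plane_ex1:
  assumes "hyperbolic 3 e f"
  shows "\<exists>!x. x \<in> R \<and> h x (e 0) = 0 \<and> h x (e 1) = 0 \<and> h x (e 2) = 0"
proof -
  have s: "i < 3 \<longleftrightarrow> i = 0 \<or> i = 1 \<or> i = 2" for i :: nat by auto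
  show ?thesis using R_plane[OF assms] unfolding hyperbolic_span_iff[OF assms] s
    by (simp add: all_simps conj_disj_distribR) metis
qed

lemma plane_unique:
  assumes "hyperbolic 3 e f" "x \<in> R" "y \<in> R" "h x (e 0) = 0" "h x (e 1) = 0" "h x (e 2) = 0"
    "h y (e 0) = 0" "h y (e 1) = 0" "h y (e 2) = 0"
  shows "x = y"
  using plane_ex1[OF assms(1)] assms by blast

text \<open>Two orthogonal isotropic vectors, proportional or not, lie in a common generator, which
  contains only one vector of \<open>R\<close>.\<close>

lemma R_not_orthogonal:
  assumes "x \<in> R" "y \<in> R" "x \<noteq> y"
  shows "h x y \<noteq> 0"
proof
  assume xy: "h x y = 0"
  note x = R_isotropic[OF assms(1)] and y = R_isotropic[OF assms(2)]
  have yx: "h y x = 0" using xy h_zero_sym by blast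
  show False
  proof (cases "\<exists>c. y = c *s x")
    case True
    then obtain c where c: "y = c *s x" ..
    obtain e f where ef: "hyperbolic 3 e f" "e 0 = x" using hyperbolic_point[of x] x by auto
    note D = hyperbolic3D[OF ef(1), unfolded ef(2)]
    have "x = y" by (rule plane_unique[OF ef(1) assms(1,2)]) (simp_all add: c D ef(2))
    thus False using assms by simp
  next
    case False
    then obtain e f where ef: "hyperbolic 3 e f" "e 0 = x" "e 1 = y"
      using hyperbolic_line[of x y] x y xy by auto
    note D = hyperbolic3D[OF ef(1), unfolded ef(2,3)]
    have "x = y" by (rule plane_unique[OF ef(1) assms(1,2)]) (simp_all add: D ef(2,3))
    thus False using assms by simp
  qed
qed

text \<open>The hypothesis \<open>no\<close> says that the line of \<open>e 0\<close> and
  \<open>e 1\<close> misses \<open>R\<close>. Exactly three generators contain this line, through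
  \<open>e 2\<close>, \<open>f 2\<close> and \<open>e 2 + f 2\<close>, and each contributes one
  vector.\<close>

lemma card_line_perp:
  assumes H: "hyperbolic 3 e f"
    and no: "\<And>x. x \<in> R \<Longrightarrow> h x (e 0) = 0 \<Longrightarrow> h x (e 1) = 0 \<Longrightarrow> h x (e 2) = 0 \<Longrightarrow> h x (f 2) = 0 \<Longrightarrow> False"
  shows "card {x \<in> R. h x (e 0) = 0 \<and> h x (e 1) = 0} = 3"
proof -
  note D = hyperbolic3D[OF H]
  have H2: "hyperbolic 3 (e(2 := f 2)) (f(2 := e 2))"
    by (rule hyperbolic3I) (simp_all add: D)
  have H3: "hyperbolic 3 (e(2 := e 2 + f 2)) f"
    by (rule hyperbolic3I) (simp_all add: D)
  obtain x1 where x1: "x1 \<in> R" "h x1 (e 0) = 0" "h x1 (e 1) = 0" "h x1 (e 2) = 0"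
    using plane_ex1[OF H] by auto
  obtain x2 where x2: "x2 \<in> R" "h x2 (e 0) = 0" "h x2 (e 1) = 0" "h x2 (f 2) = 0"
    using plane_ex1[OF H2] by auto
  obtain x3 where x3: "x3 \<in> R" "h x3 (e 0) = 0" "h x3 (e 1) = 0" "h x3 (e 2) + h x3 (f 2) = 0"
    using plane_ex1[OF H3] by auto
  have "{x \<in> R. h x (e 0) = 0 \<and> h x (e 1) = 0} = {x1, x2, x3}"
  proof (intro equalityI subsetI)
    fix x assume "x \<in> {x \<in> R. h x (e 0) = 0 \<and> h x (e 1) = 0}"
    hence x: "x \<in> R" "h x (e 0) = 0" "h x (e 1) = 0" by auto
    define a where "a = h x (f 2)"
    define b where "b = h x (e 2)"
    have ab: "h (e 2) x = b\<^sup>2" "h (f 2) x = a\<^sup>2" unfolding a_def b_def by (rule h_sym)+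
    have z: "h (e 0) x = 0" "h (e 1) x = 0" using x h_zero_sym by blast+
    \<comment> \<open>Modulo the line, \<open>x\<close> is \<open>a *s e 2 + b *s f 2\<close>;
      isotropy means \<open>a * b * (a + b) = 0\<close>, which singles out the three
      generators.\<close>
    have "h x x = a * b\<^sup>2 + b * a\<^sup>2"
      by (subst (1) expand3[OF H, of x]) (simp add: x z ab a_def[symmetric] b_def[symmetric])
    also have "\<dots> = a * b * (a + b)" by (simp add: power2_eq_square algebra_simps)
    finally have "a = 0 \<or> b = 0 \<or> a + b = 0" using R_isotropic[OF x(1)] by auto
    thus "x \<in> {x1, x2, x3}"
    proof (elim disjE)
      assume "a = 0" thus ?thesis
        using plane_unique[OF H2, of x x2] x x2 by (simp add: a_def)
    next
      assume "b = 0" thus ?thesis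
        using plane_unique[OF H, of x x1] x x1 by (simp add: b_def)
    next
      assume "a + b = 0" thus ?thesis
        using plane_unique[OF H3, of x x3] x x3 by (simp add: a_def b_def add.commute)
    qed
  qed (use x1 x2 x3 in auto)
  moreover have "x1 \<noteq> x2" "x1 \<noteq> x3" "x2 \<noteq> x3"
    using no[of x1] no[of x2] x1 x2 x3 by auto
  ultimately show ?thesis by simp
qed

text \<open>Fix a plane through \<open>p\<close> and its ovoid vector \<open>y\<close>. Any other
  \<open>x\<close> counted here is orthogonal to exactly one of the four lines through
  \<open>p\<close> in this plane that miss \<open>y\<close>. Each such line has three vectors,
  \<open>y\<close> included: \<open>1 + 4 * 2 = 9\<close>.\<close>

lemma card_point_perp:
  assumes p: "p \<noteq> 0" "h p p = 0" and no: "\<And>x c. x \<in> R \<Longrightarrow> x = c *s p \<Longrightarrow> False"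
  shows "card {x \<in> R. h x p = 0} = 9"
proof -
  obtain e f where "hyperbolic 3 e f" "e 0 = p" using hyperbolic_point[OF p] by auto
  then obtain y where y: "y \<in> R" "h y p = 0" using plane_ex1 by metis
  have py: "h p y = 0" using y h_zero_sym by blast
  obtain e f where H: "hyperbolic 3 e f" and e: "e 0 = p" "e 1 = y"
    using hyperbolic_line[of p y] p R_isotropic[OF y(1)] py no[OF y(1)] by auto
  note D = hyperbolic3D[OF H]
  let ?g = "\<lambda>c. e 2 + c *s e 1"
  have "card {x \<in> R. h x p = 0} = Suc (CARD('a) * 2)"
  proof (rule card_pencil[of _ y "\<lambda>c. {x \<in> R. h x p = 0 \<and> h x (?g c) = 0}"])
    show "y \<in> {x \<in> R. h x p = 0}" using y by simp
    show "y \<in> {x \<in> R. h x p = 0 \<and> h x (?g c) = 0}" for c using y D[unfolded e] by (simp add: e)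
    show "\<exists>!c. x \<in> {x \<in> R. h x p = 0 \<and> h x (?g c) = 0}" if "x \<in> {x \<in> R. h x p = 0} - {y}" for x
    proof -
      have xy: "h x y \<noteq> 0" using that R_not_orthogonal y by auto
      show ?thesis
      proof (rule ex1I[of _ "(h x (e 2) / h x y)\<^sup>2"])
        fix c assume "x \<in> {x \<in> R. h x p = 0 \<and> h x (?g c) = 0}"
        hence "h x (e 2) = - (c\<^sup>2 * h x y)" by (simp only: e eq_neg_iff_add_eq_0) (simp add: e)
        hence "c\<^sup>2 = h x (e 2) / h x y" using xy by simp
        thus "c = (h x (e 2) / h x y)\<^sup>2" by (metis square_square)
      qed (use that xy in \<open>simp add: e power_divide\<close>)
    qed
    show "card {x \<in> R. h x p = 0 \<and> h x (?g c) = 0} = Suc 2" for c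
    proof -
      \<comment> \<open>This is a basis adapted to the line of \<open>p\<close> and
        \<open>?g c\<close>, still spanning the old plane; so a vector of \<open>R\<close> on that
        line would have to be \<open>y\<close>.\<close>
      let ?e = "e(1 := ?g c, 2 := e 1)" and ?f = "f(1 := f 2, 2 := f 1 + c\<^sup>2 *s f 2)"
      have H': "hyperbolic 3 ?e ?f"
        by (rule hyperbolic3I) (simp_all add: D)
      have "card {x \<in> R. h x (?e 0) = 0 \<and> h x (?e 1) = 0} = 3"
      proof (rule card_line_perp[OF H'])
        fix x assume x: "x \<in> R" "h x (?e 0) = 0" "h x (?e 1) = 0" "h x (?e 2) = 0" "h x (?f 2) = 0"
        hence "x = e 1" using plane_unique[OF H x(1) y(1)] by (simp add: e D[unfolded e])
        thus False using x(5) by (simp add: D)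
      qed
      thus ?thesis by (simp add: e)
    qed
  qed auto
  thus ?thesis by (simp add: q4)
qed

text \<open>Each vector of \<open>R\<close> other than \<open>y\<close> is orthogonal to just one of
  the four points \<open>e 1 + c *s y\<close> of a totally isotropic line through \<open>y\<close>.
  Each of these points sees nine vectors, one being \<open>y\<close>:
  \<open>1 + 4 * 8 = 33\<close>.\<close>

lemma card_R: "card R = 33"
proof -
  obtain e f where "hyperbolic 3 e f" using ex_hyperbolic by blast
  then obtain y where y: "y \<in> R" using plane_ex1 by metis
  obtain e f where H: "hyperbolic 3 e f" and e: "e 0 = y"
    using hyperbolic_point[of y] R_isotropic[OF y] by auto
  note D = hyperbolic3D[OF H]
  let ?g = "\<lambda>c. e 1 + c *s e 0"
  have "card R = Suc (CARD('a) * 8)"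
  proof (rule card_pencil[of _ y "\<lambda>c. {x \<in> R. h x (?g c) = 0}"])
    show "y \<in> {x \<in> R. h x (?g c) = 0}" for c using y D[unfolded e] by (simp add: e)
    show "\<exists>!c. x \<in> {x \<in> R. h x (?g c) = 0}" if "x \<in> R - {y}" for x
    proof -
      have xy: "h x y \<noteq> 0" using that R_not_orthogonal y by auto
      show ?thesis
      proof (rule ex1I[of _ "(h x (e 1) / h x y)\<^sup>2"])
        fix c assume "x \<in> {x \<in> R. h x (?g c) = 0}"
        hence "h x (e 1) = - (c\<^sup>2 * h x y)" by (simp only: e eq_neg_iff_add_eq_0) (simp add: e)
        hence "c\<^sup>2 = h x (e 1) / h x y" using xy by simp
        thus "c = (h x (e 1) / h x y)\<^sup>2" by (metis square_square)
      qed (use that xy in \<open>simp add: e power_divide\<close>)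
    qed
    show "card {x \<in> R. h x (?g c) = 0} = Suc 8" for c
    proof -
      have "card {x \<in> R. h x (?g c) = 0} = 9"
      proof (rule card_point_perp)
        show "?g c \<noteq> 0"
        proof
          assume "?g c = 0"
          hence "h (?g c) (f 1) = 0" by simp
          thus False by (simp add: D)
        qed
        show "h (?g c) (?g c) = 0" by (simp add: D)
        fix x d assume x: "x \<in> R" "x = d *s ?g c"
        hence "h x y = 0" by (simp add: e D[unfolded e])
        hence "x = y" using R_not_orthogonal x y by blast
        moreover have "h x (f 1) = d" unfolding x(2) by (simp add: D)
        ultimately have "d = 0" by (simp add: e D[unfolded e])
        thus False using x R_isotropic by auto
      qed
      thus ?thesis by simp
    qed
  qed (use y in auto)
  thus ?thesis by (simp add: q4)
qed

lemma card_point_perp_cases: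
  assumes p: "p \<noteq> 0" "h p p = 0"
  shows "card {x \<in> R. h x p = 0} = 1 \<or> card {x \<in> R. h x p = 0} = 9"
proof (cases "\<exists>x\<in>R. \<exists>c. x = c *s p")
  case True
  then obtain x c where x: "x \<in> R" "x = c *s p" by blast
  have "y = x" if y: "y \<in> R" "h y p = 0" for y
  proof -
    have "h y x = 0" unfolding x(2) by (simp add: y)
    thus ?thesis using R_not_orthogonal y(1) x(1) by blast
  qed
  moreover have "h x p = 0" unfolding x(2) by (simp add: p)
  ultimately have "{x \<in> R. h x p = 0} = {x}" using x(1) by blast
  thus ?thesis by simp
next
  case False
  have "card {x \<in> R. h x p = 0} = 9"
    by (rule card_point_perp[OF p]) (use False in blast)
  thus ?thesis by simp
qed

text \<open>The number is 1 if the line meets \<open>R\<close> and 3 otherwise.\<close>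

lemma odd_card_line_perp:
  assumes "p \<noteq> 0" "h p p = 0" "h r r = 0" "h p r = 0" "\<And>c. r \<noteq> c *s p"
  shows "odd (card {x \<in> R. h x p = 0 \<and> h x r = 0})"
proof -
  obtain e f where H: "hyperbolic 3 e f" and e: "e 0 = p" "e 1 = r"
    using hyperbolic_line[of p r] assms by auto
  note D = hyperbolic3D[OF H]
  show ?thesis
  proof (cases "\<exists>x\<in>R. h x (e 0) = 0 \<and> h x (e 1) = 0 \<and> h x (e 2) = 0 \<and> h x (f 2) = 0")
    case True
    then obtain x where x: "x \<in> R" "h x (e 0) = 0" "h x (e 1) = 0" "h x (e 2) = 0" "h x (f 2) = 0"
      by blast
    have "x = h x (f 0) *s e 0 + h x (f 1) *s e 1"
      by (subst (1) expand3[OF H, of x]) (simp add: x)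
    hence "h y x = 0" if "h y p = 0" "h y r = 0" for y
      using that h_simps(2,4) by (metis e add_0 mult_zero_right)
    hence "{x \<in> R. h x p = 0 \<and> h x r = 0} = {x}"
      using x R_not_orthogonal e by auto
    thus ?thesis by simp
  next
    case False
    thus ?thesis using card_line_perp[OF H] e by auto
  qed
qed

end

subsection \<open>Hermitian forms vanishing on isotropic points\<close>

context hermitian_space
begin

abbreviation hform :: "('a ^ 'm \<Rightarrow> 'a ^ 'm \<Rightarrow> 'a) \<Rightarrow> bool" where
  "hform \<equiv> hermitian_form (\<lambda>x. x ^ 2)"

lemma trace_zero_iff': "(a::'a)\<^sup>2 + a = 0 \<longleftrightarrow> a = 0 \<or> a = 1"
  using trace_zero_iff[of a] by (simp add: add.commute)

lemma hform_add:
  assumes "hform B" "hform C"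
  shows "hform (\<lambda>v w. B v w + C v w)"
  using hermD(1-4)[OF assms(1)] hermD(1-4)[OF assms(2)]
    hermD(5)[OF assms(1), symmetric] hermD(5)[OF assms(2), symmetric]
  unfolding hermitian_form_def by (simp add: algebra_simps)

text \<open>Hermitian forms are a vector space over GF(2) only, since the scalar must be fixed by
  squaring.\<close>

lemma hform_scale:
  assumes "hform B" "c \<in> {0, 1}"
  shows "hform (\<lambda>v w. c * B v w)"
  using assms hermD(1-4)[OF assms(1)] hermD(5)[OF assms(1), symmetric]
  unfolding hermitian_form_def by (auto simp: algebra_simps)

lemma hform_add_scale:
  assumes "hform B" "c \<in> {0, 1}"
  shows "hform (\<lambda>v w. B v w + c * h v w)"
  using hform_add[OF assms(1) hform_scale[OF herm assms(2)]] .

lemma hform_self: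
  assumes "hform B" shows "B v v \<in> {0, 1}"
proof -
  have "B v v + (B v v)\<^sup>2 = 0" by (simp only: hermD(5)[OF assms, of v v, symmetric] add_self)
  thus ?thesis by (simp add: trace_zero_iff)
qed

lemma hform_zeroI:
  assumes "hform B" "\<And>v. B v v = 0"
  shows "B v w = 0"
  using polarize[OF assms(1) vec.subspace_UNIV] assms(2) by blast

lemma hform_eqI:
  assumes "hform B" "hform C" "\<And>v. B v v = C v v"
  shows "B v w = C v w"
proof -
  have "B v w + C v w = 0"
    by (rule hform_zeroI[OF hform_add[OF assms(1,2)]]) (simp add: assms(3))
  thus ?thesis by (metis add.right_neutral add_self2)
qed

lemma hform_pair_zero:
  assumes B: "hform B" and z: "\<And>c. B (p + c *s r) (p + c *s r) = 0" and "B r r = 0"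
  shows "B p r = 0" "B r p = 0"
proof -
  show "B p r = 0"
  proof (rule trace_form_nondeg)
    fix c
    from z[of c] z[of 0] assms(3) show "B p r * c\<^sup>2 + (B p r)\<^sup>2 * c = 0"
      by (simp add: hermD(1-4)[OF B] hermD(5)[OF B, of r p] algebra_simps)
  qed
  thus "B r p = 0" by (simp add: hermD(5)[OF B, of r p])
qed

lemma of_nat_parity: "(of_nat k :: 'a) = (if even k then 0 else 1)"
  by (induction k) auto

section \<open>Sums of rank-one forms and their diagonal parities\<close>

definition sum_form :: "('a ^ 'm) set \<Rightarrow> 'a ^ 'm \<Rightarrow> 'a ^ 'm \<Rightarrow> 'a" where
  "sum_form T v w = (\<Sum>x\<in>T. h v x * h x w)"

lemma hform_sum_form: "hform (sum_form T)"
proof -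
  have sym: "(\<Sum>x\<in>T. h y x * h x v) = (\<Sum>x\<in>T. h v x * h x y)\<^sup>2" for y v
  proof -
    have "(\<Sum>x\<in>T. g x)\<^sup>2 = (\<Sum>x\<in>T. (g x)\<^sup>2)" for g :: "'a ^ 'm \<Rightarrow> 'a"
      by (induction T rule: infinite_finite_induct) auto
    moreover have "h y x * h x v = (h v x * h x y)\<^sup>2" for x
      by (simp add: power_mult_distrib h_sym[symmetric] mult.commute)
    ultimately show ?thesis by simp
  qed
  show ?thesis unfolding hermitian_form_def sum_form_def
    by (intro conjI allI sym) (simp_all add: algebra_simps sum.distrib sum_distrib_left)
qed

text \<open>This is the norm from GF(4) to GF(2): by hermitian symmetry the product is a
  cube.\<close>

lemma h_norm: "h v x * h x v = (if h x v = 0 then 0 else 1)"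
proof (cases "h x v = 0")
  case False
  have "h v x * h x v = h x v ^ 3" by (subst h_sym[of v x]) (simp add: power2_eq_square power3_eq_cube)
  thus ?thesis using f4_cube[OF q4 False] False by simp
qed simp

lemma sum_form_self: "sum_form T v v = of_nat (card {x \<in> T. h x v \<noteq> 0})"
proof -
  have "sum_form T v v = (\<Sum>x\<in>T. if h x v \<noteq> 0 then 1 else 0)"
    unfolding sum_form_def h_norm by (rule sum.cong) auto
  also have "\<dots> = (\<Sum>x\<in>{x \<in> T. h x v \<noteq> 0}. 1)" by (subst sum.inter_filter) auto
  finally show ?thesis by simp
qed

end

context ovoid6
begin

lemma hform_basis_zero:
  assumes B: "hform B" and H: "hyperbolic 3 e f"
    and z: "\<And>u u'. u \<in> {e 0, e 1, e 2, f 0, f 1, f 2} \<Longrightarrow> u' \<in> {e 0, e 1, e 2, f 0, f 1, f 2} \<Longrightarrow> B u u' = 0"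
  shows "B v w = 0"
proof -
  note BD = hermD(1-4)[OF B]
  have "B u w = 0" if "u \<in> {e 0, e 1, e 2, f 0, f 1, f 2}" for u
    by (subst (1) expand3[OF H, of w]) (simp add: BD z[OF that])
  thus ?thesis by (subst (1) expand3[OF H, of v]) (simp add: BD)
qed

text \<open>Polarization on totally isotropic lines kills all entries of \<open>B\<close> on the
  basis of the hyperplane except those at the pairs \<open>e 1, f 1\<close> and
  \<open>e 2, f 2\<close>; these lie in GF(2) and turn out equal.\<close>

lemma vanish_on_perp:
  assumes B: "hform B" and H: "hyperbolic 3 e f"
    and z: "\<And>v. h v v = 0 \<Longrightarrow> h v (e 0) = 0 \<Longrightarrow> B v v = 0"
  shows "\<exists>c\<in>{0,1}. \<forall>v. h v (e 0) = 0 \<longrightarrow> B v v = c * h v v"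
proof -
  note D = hyperbolic3D[OF H] and BD = hermD(1-4)[OF B]
  obtain w :: 'a where w: "w \<noteq> 0" "w \<noteq> 1" "w * w = w + 1" using f4_omega[OF q4] by blast
  have diag: "B (e 0) (e 0) = 0" "B (e 1) (e 1) = 0" "B (e 2) (e 2) = 0"
      "B (f 1) (f 1) = 0" "B (f 2) (f 2) = 0"
    by (rule z; simp add: D)+
  have off: "B p r = 0 \<and> B r p = 0" if "h p p = 0" "h r r = 0" "h p r = 0" "h p (e 0) = 0" "h r (e 0) = 0" for p r
  proof -
    have rp: "h r p = 0" using that h_zero_sym by blast
    have "B (p + c *s r) (p + c *s r) = 0" for c by (rule z) (use that rp in simp_all)
    moreover have "B r r = 0" using z that by blast
    ultimately show ?thesis using hform_pair_zero[OF B] by blast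
  qed
  have o: "B (e 0) (e 1) = 0 \<and> B (e 1) (e 0) = 0" "B (e 0) (e 2) = 0 \<and> B (e 2) (e 0) = 0"
    "B (e 1) (e 2) = 0 \<and> B (e 2) (e 1) = 0" "B (e 0) (f 1) = 0 \<and> B (f 1) (e 0) = 0"
    "B (e 0) (f 2) = 0 \<and> B (f 2) (e 0) = 0" "B (e 1) (f 2) = 0 \<and> B (f 2) (e 1) = 0"
    "B (e 2) (f 1) = 0 \<and> B (f 1) (e 2) = 0" "B (f 1) (f 2) = 0 \<and> B (f 2) (f 1) = 0"
    by (rule off; simp add: D)+
  define a where "a = B (e 1) (f 1)"
  define b where "b = B (e 2) (f 2)"
  have sq: "B (f 1) (e 1) = a\<^sup>2" "B (f 2) (e 2) = b\<^sup>2" unfolding a_def b_def by (rule hermD(5)[OF B])+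
  have "B (e 1 + f 1) (e 1 + f 1) = 0" "B (e 2 + f 2) (e 2 + f 2) = 0" by (rule z; simp add: D)+
  hence "a = 0 \<or> a = 1" "b = 0 \<or> b = 1"
    by (simp_all add: BD diag sq a_def[symmetric] b_def[symmetric] trace_zero_iff trace_zero_iff')
  \<comment> \<open>Each half \<open>e i + w *s f i\<close> has norm 1, so the sum is isotropic; it
    couples \<open>a\<close> with \<open>b\<close>.\<close>
  moreover have "B (e 1 + w *s f 1 + e 2 + w *s f 2) (e 1 + w *s f 1 + e 2 + w *s f 2) = 0"
    by (rule z) (simp_all add: D)
  hence "w\<^sup>2 * a + (w * a\<^sup>2 + (w\<^sup>2 * b + w * b\<^sup>2)) = 0"
    by (simp add: BD diag sq o a_def[symmetric] b_def[symmetric] ac_simps)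
  ultimately have ab: "a \<in> {0, 1}" "b = a" using w(3) by (auto simp: power2_eq_square)
  have "B v v = a * h v v" if "h v (e 0) = 0" for v
  proof -
    define x0 x1 x2 y1 y2 where x: "x0 = h v (f 0)" "x1 = h v (f 1)" "x2 = h v (f 2)" "y1 = h v (e 1)" "y2 = h v (e 2)"
    have v: "v = x0 *s e 0 + x1 *s e 1 + x2 *s e 2 + y1 *s f 1 + y2 *s f 2"
      unfolding x by (subst (1) expand3[OF H, of v]) (simp add: that)
    have "B v v = x1 * (y1\<^sup>2 * a) + y1 * (x1\<^sup>2 * a\<^sup>2) + x2 * (y2\<^sup>2 * a) + y2 * (x2\<^sup>2 * a\<^sup>2)"
      unfolding v by (simp add: BD diag sq o a_def[symmetric] b_def[symmetric] ab algebra_simps)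
    moreover have "h v v = x1 * y1\<^sup>2 + y1 * x1\<^sup>2 + x2 * y2\<^sup>2 + y2 * x2\<^sup>2"
      unfolding v by (simp add: D algebra_simps)
    ultimately show ?thesis using ab(1) by (auto simp: algebra_simps)
  qed
  thus ?thesis using ab(1) by blast
qed

text \<open>Subtract the multiple of \<open>h\<close> found on a tangent hyperplane. The remaining
  form \<open>C\<close> can only be nonzero on pairs involving \<open>f 0\<close>, and isotropic
  vectors eliminate these too.\<close>

lemma vanish_on_isotropic:
  assumes B: "hform B" and z: "\<And>v. h v v = 0 \<Longrightarrow> B v v = 0"
  shows "\<exists>c\<in>{0,1}. \<forall>v w. B v w = c * h v w"
proof -
  obtain e f where H: "hyperbolic 3 e f" using ex_hyperbolic by blast
  note D = hyperbolic3D[OF H]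
  obtain w :: 'a where w: "w \<noteq> 0" "w \<noteq> 1" "w * w = w + 1" using f4_omega[OF q4] by blast
  obtain c where c: "c \<in> {0,1}" "\<And>v. h v (e 0) = 0 \<Longrightarrow> B v v = c * h v v"
    using vanish_on_perp[OF B H] z by blast
  define C where "C = (\<lambda>v w. B v w + c * h v w)"
  have C: "hform C" unfolding C_def by (rule hform_add_scale[OF B c(1)])
  note CD = hermD(1-4)[OF C]
  have zC: "C v v = 0" if "h v v = 0 \<or> h v (e 0) = 0" for v
    using that z c(2) by (auto simp: C_def)
  have perp: "C u u' = 0" if "h u (e 0) = 0" "h u' (e 0) = 0" for u u'
  proof (rule polarize[OF C])
    show "vec.subspace {v. h v (e 0) = 0}" by (auto simp: vec.subspace_def)
  qed (use that zC in auto)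
  have off: "C p (f 0) = 0 \<and> C (f 0) p = 0" if "h p p = 0" "h (f 0) p = 0" for p
  proof -
    have pf: "h p (f 0) = 0" using that h_zero_sym by blast
    have "C (p + c *s f 0) (p + c *s f 0) = 0" for c
      by (intro zC disjI1) (use that pf D in simp_all)
    moreover have "C (f 0) (f 0) = 0" by (rule zC) (simp add: D)
    ultimately show ?thesis using hform_pair_zero[OF C] by blast
  qed
  have o: "C (e 1) (f 0) = 0 \<and> C (f 0) (e 1) = 0" "C (e 2) (f 0) = 0 \<and> C (f 0) (e 2) = 0"
    "C (f 1) (f 0) = 0 \<and> C (f 0) (f 1) = 0" "C (f 2) (f 0) = 0 \<and> C (f 0) (f 2) = 0"
    by (rule off; simp add: D)+
  have d: "C (f 0) (f 0) = 0" by (rule zC) (simp add: D)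
  define a where "a = C (e 0) (f 0)"
  have sq: "C (f 0) (e 0) = a\<^sup>2" unfolding a_def by (rule hermD(5)[OF C])
  have "C (e 0 + f 0) (e 0 + f 0) = 0" by (rule zC) (simp add: D)
  hence "a = 0 \<or> a = 1" by (simp add: CD d perp D sq a_def[symmetric] trace_zero_iff trace_zero_iff')
  \<comment> \<open>The part \<open>e 1 + w *s f 1\<close> makes the vector isotropic but
    contributes nothing to \<open>C\<close>, which leaves an equation in \<open>a\<close>
    alone.\<close>
  moreover have "C (e 0 + w *s f 0 + e 1 + w *s f 1) (e 0 + w *s f 0 + e 1 + w *s f 1) = 0"
    by (rule zC) (simp add: D)
  hence "w\<^sup>2 * a + w * a\<^sup>2 = 0"
    by (simp add: CD d perp D sq o a_def[symmetric] ac_simps)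
  ultimately have "a = 0" using w(3) by (auto simp: power2_eq_square)
  hence a: "C (e 0) (f 0) = 0" "C (f 0) (e 0) = 0" using a_def sq by auto
  have "C v w = 0" for v w
  proof (rule hform_basis_zero[OF C H])
    fix u u' assume u: "u \<in> {e 0, e 1, e 2, f 0, f 1, f 2}" "u' \<in> {e 0, e 1, e 2, f 0, f 1, f 2}"
    have "h u (e 0) = 0 \<or> u = f 0" "h u' (e 0) = 0 \<or> u' = f 0" using u D by auto
    moreover have "C (f 0) u' = 0" "C u (f 0) = 0" using u a o d by blast+
    ultimately show "C u u' = 0" using perp by blast
  qed
  hence "B v w + c * h v w = 0" for v w by (simp add: C_def)
  hence "B v w = c * h v w" for v w by (metis add.right_neutral add_self2)
  thus ?thesis using c(1) by blast
qed

text \<open>Two hermitian forms, one vanishing on \<open>p\<^sup>\<bottom>\<close> and one on \<open>r\<^sup>\<bottom>\<close>, that agree modulo \<open>h\<close> are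
  equal and have rank two, so that their common zeros lie in the union of three tangent
  hyperplanes: too few for an ovoid.\<close>

lemma no_common_form:
  assumes M: "hform M" and M': "hform M'" and nz: "\<not> (\<forall>v. M v v = 0)"
    and p: "p \<noteq> 0" "h p p = 0" and r: "h r r = 0" and pr: "h p r = 0" "\<And>c. r \<noteq> c *s p"
    and Mp: "\<And>v. h v p = 0 \<Longrightarrow> M v v = 0" and Mr: "\<And>v. h v r = 0 \<Longrightarrow> M' v v = 0"
    and eq: "c \<in> {0,1}" "\<And>v. M v v = M' v v + c * h v v"
    and MR: "\<And>x. x \<in> R \<Longrightarrow> M x x = 0"
  shows False
proof -
  obtain e f where H: "hyperbolic 3 e f" and e: "e 0 = p" "e 1 = r"
    using hyperbolic_line[of p r] assms by auto
  note D = hyperbolic3D[OF H] and MD = hermD(1-4)[OF M]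
  obtain w :: 'a where w: "w \<noteq> 0" "w \<noteq> 1" "w * w = w + 1" using f4_omega[OF q4] by blast
  \<comment> \<open>This vector has norm 1 and is orthogonal to \<open>p\<close> and
    \<open>r\<close>, so both forms vanish on it and \<open>c\<close> must be 0.\<close>
  have "c * h (e 2 + w *s f 2) (e 2 + w *s f 2) = 0"
    using eq(2)[of "e 2 + w *s f 2"] Mp[of "e 2 + w *s f 2"] Mr[of "e 2 + w *s f 2"]
    by (simp add: D[unfolded e])
  hence "c = 0" using w by (simp add: D power2_eq_square)
  hence Mr: "M v v = 0" if "h v r = 0" for v using that Mr eq(2) by simp
  have perp: "M u u' = 0" if "h u p = 0" "h u' p = 0" for u u'
  proof (rule polarize[OF M])
    show "vec.subspace {v. h v p = 0}" by (auto simp: vec.subspace_def)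
  qed (use that Mp in auto)
  have perp': "M u u' = 0" if "h u r = 0" "h u' r = 0" for u u'
  proof (rule polarize[OF M])
    show "vec.subspace {v. h v r = 0}" by (auto simp: vec.subspace_def)
  qed (use that Mr in auto)
  \<comment> \<open>The only surviving entry: basis pairs avoiding \<open>f 0\<close> lie in one
    hyperplane, those avoiding \<open>f 1\<close> in the other.\<close>
  define a where "a = M (f 0) (f 1)"
  have sq: "M (f 1) (f 0) = a\<^sup>2" unfolding a_def by (rule hermD(5)[OF M])
  define S where "S = {e 0, e 1, e 2, f 0, f 1, f 2}"
  have S: "e 0 \<in> S" "e 1 \<in> S" "e 2 \<in> S" "f 0 \<in> S" "f 1 \<in> S" "f 2 \<in> S" by (auto simp: S_def)
  have hp: "h u p = 0" if "u \<in> S" "u \<noteq> f 0" for u using that D[unfolded e] e by (auto simp: S_def)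
  have hr: "h u r = 0" if "u \<in> S" "u \<noteq> f 1" for u using that D[unfolded e] e by (auto simp: S_def)
  have "f 0 \<noteq> f 1" using D(22,31) by auto
  hence z: "M u u' = 0" if "u \<in> S" "u' \<in> S" "(u, u') \<noteq> (f 0, f 1)" "(u, u') \<noteq> (f 1, f 0)" for u u'
    using that perp[OF hp hp] perp'[OF hr hr] by (cases "u = f 0 \<or> u' = f 0") auto
  have Mv: "M v v = h v p * ((h v r)\<^sup>2 * a) + h v r * ((h v p)\<^sup>2 * a\<^sup>2)" for v
  proof -
    define x0 x1 x2 y0 y1 y2 where x: "x0 = h v (f 0)" "x1 = h v (f 1)" "x2 = h v (f 2)"
       "y0 = h v p" "y1 = h v r" "y2 = h v (e 2)"
    have v: "v = x0 *s e 0 + x1 *s e 1 + x2 *s e 2 + y0 *s f 0 + y1 *s f 1 + y2 *s f 2"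
      unfolding x e[symmetric] by (rule expand3[OF H])
    have zz: "\<And>u'. u' \<in> S - {f 1} \<Longrightarrow> M (f 0) u' = 0" "\<And>u'. u' \<in> S - {f 0} \<Longrightarrow> M (f 1) u' = 0"
      "\<And>u u'. u \<in> S - {f 0, f 1} \<Longrightarrow> u' \<in> S \<Longrightarrow> M u u' = 0"
      by (rule z; use \<open>f 0 \<noteq> f 1\<close> S in blast)+
    have ne: "e i \<noteq> f j" if "i < 3" "j < 3" for i j
      using hyperbolicD(1)[OF H that] hyperbolicD(4)[OF H that(2) that(2)] by auto
    have ne': "f 2 \<noteq> f 0" "f 2 \<noteq> f 1" using D(22,23,32,34) by auto
    have "M u v = 0" if "u \<in> S - {f 0, f 1}" for u
      unfolding v by (simp add: MD zz(3)[OF that] S)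
    hence "M (e 0) v = 0" "M (e 1) v = 0" "M (e 2) v = 0" "M (f 2) v = 0"
      using ne ne' S by auto
    moreover have "M (f 0) v = y1\<^sup>2 * a"
      by (subst (1) v) (simp add: MD zz(1) S ne ne' \<open>f 0 \<noteq> f 1\<close> a_def)
    moreover have "M (f 1) v = y0\<^sup>2 * a\<^sup>2"
      by (subst (1) v) (simp add: MD zz(2) S ne ne' \<open>f 0 \<noteq> f 1\<close>[symmetric] sq)
    ultimately show ?thesis unfolding x(4,5)[symmetric]
      by (subst (1) v) (simp add: MD)
  qed
  have "a \<noteq> 0" using nz Mv by auto
  \<comment> \<open>With \<open>s = h v p\<close> and \<open>t = h v r\<close>, the form is
    \<open>s * t * a * (t + s * a)\<close>; this \<open>d\<close> makes the last factor the equation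
    of the hyperplane orthogonal to \<open>p + d *s r\<close>.\<close>
  define d where "d = (1 / a)\<^sup>2"
  have "R \<subseteq> {x \<in> R. h x p = 0} \<union> {x \<in> R. h x r = 0} \<union> {x \<in> R. h x (p + d *s r) = 0}"
  proof
    fix x assume x: "x \<in> R"
    show "x \<in> {x \<in> R. h x p = 0} \<union> {x \<in> R. h x r = 0} \<union> {x \<in> R. h x (p + d *s r) = 0}"
    proof (cases "h x p = 0 \<or> h x r = 0")
      case False
      define s t where st: "s = h x p" "t = h x r"
      have "s * t * a * (t + s * a) = 0"
        using MR[OF x] unfolding Mv st[symmetric] by (simp add: power2_eq_square algebra_simps)
      hence "t + s * a = 0" using False \<open>a \<noteq> 0\<close> by (simp add: st)
      hence "(1 / a) * (t + s * a) = 0" by simp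
      hence "s + t * (1 / a) = 0" using \<open>a \<noteq> 0\<close> by (simp add: algebra_simps)
      thus ?thesis using x by (simp add: d_def st mult.commute)
    qed (use x in auto)
  qed
  hence "card R \<le> card ({x \<in> R. h x p = 0} \<union> {x \<in> R. h x r = 0} \<union> {x \<in> R. h x (p + d *s r) = 0})"
    by (intro card_mono) auto
  also have "\<dots> \<le> card {x \<in> R. h x p = 0} + card {x \<in> R. h x r = 0} + card {x \<in> R. h x (p + d *s r) = 0}"
    by (meson card_Un_le add_le_mono1 order_trans)
  also have "\<dots> \<le> 9 + 9 + 9"
  proof (intro add_mono)
    have le: "card {x \<in> R. h x q = 0} \<le> 9" if "q \<noteq> 0" "h q q = 0" for q
      using card_point_perp_cases[OF that] by auto
    have "h r p = 0" using pr h_zero_sym by blast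
    moreover have "p + d *s r \<noteq> 0"
    proof
      assume "p + d *s r = 0"
      hence "h (p + d *s r) (f 0) = 0" by simp
      thus False using D(19,27) by (simp add: e)
    qed
    ultimately show "card {x \<in> R. h x (p + d *s r) = 0} \<le> 9" using p r pr by (intro le) auto
    show "card {x \<in> R. h x p = 0} \<le> 9" using p by (rule le)
    show "card {x \<in> R. h x r = 0} \<le> 9" using r pr(2)[of 0] by (intro le) auto
  qed
  finally show False by (simp add: card_R)
qed

end

subsection \<open>The forms attached to isotropic points\<close>

lemma zero_one_add:
  fixes a b :: "'a::{field,finite}"
  assumes "CARD('a) = 4" "a \<in> {0, 1}" "b \<in> {0, 1}"
  shows "a + b \<in> {0, 1}"
  using assms f4_add_self[OF assms(1), of 1] by auto

context ovoid6
begin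

definition kappa :: "'a ^ 'm \<Rightarrow> 'a ^ 'm \<Rightarrow> 'a ^ 'm \<Rightarrow> 'a" where
  "kappa p v w = h v p * h p w + sum_form {x \<in> R. h x p = 0} v w"

lemma hform_kappa: "hform (kappa p)"
proof -
  have "hform (\<lambda>v w. sum_form {p} v w + sum_form {x \<in> R. h x p = 0} v w)"
    by (intro hform_add hform_sum_form)
  thus ?thesis by (simp add: kappa_def[abs_def] sum_form_def)
qed

lemma kappa_self:
  "kappa p v v = (if h p v = 0 then 0 else 1) + of_nat (card {x \<in> R. h x p = 0 \<and> h x v \<noteq> 0})"
  by (simp add: kappa_def h_norm sum_form_self)

text \<open>Every vector of \<open>R\<close> orthogonal to \<open>p\<close>, except \<open>y\<close>
  itself, is not orthogonal to \<open>y\<close>, and their number is odd. If \<open>y\<close> is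
  among them it drops out; if not, the norm term at \<open>p\<close> corrects the parity.\<close>

lemma kappa_R:
  assumes p: "p \<noteq> 0" "h p p = 0" and y: "y \<in> R"
  shows "kappa p y y = 0"
proof -
  have odd: "odd (card {x \<in> R. h x p = 0})" using card_point_perp_cases[OF p] by auto
  have eq: "{x \<in> R. h x p = 0 \<and> h x y \<noteq> 0} = {x \<in> R. h x p = 0} - {y}"
    using R_not_orthogonal y R_isotropic[OF y] by auto
  show ?thesis
  proof (cases "h y p = 0")
    case True
    hence "h p y = 0" using h_zero_sym by blast
    moreover have "even (card ({x \<in> R. h x p = 0} - {y}))"
      using odd True y by (simp add: card_Diff_singleton)
    ultimately show ?thesis by (simp add: kappa_self eq of_nat_parity)
  next
    case False
    hence "h p y \<noteq> 0" using h_zero_sym by blast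
    thus ?thesis using odd False by (simp add: kappa_self eq of_nat_parity)
  qed
qed

text \<open>The norm term at \<open>p\<close> vanishes, and the vectors that remain are counted by a
  difference of two odd numbers.\<close>

lemma kappa_perp:
  assumes p: "p \<noteq> 0" "h p p = 0" and r: "h r r = 0" "h r p = 0"
  shows "kappa p r r = 0"
proof -
  have pr: "h p r = 0" using r h_zero_sym by blast
  show ?thesis
  proof (cases "\<exists>c. r = c *s p")
    case True
    then obtain c where "r = c *s p" ..
    hence empty: "{x \<in> R. h x p = 0 \<and> h x r \<noteq> 0} = {}" by auto
    show ?thesis unfolding kappa_self empty by (simp add: pr)
  next
    case False
    have "{x \<in> R. h x p = 0} = {x \<in> R. h x p = 0 \<and> h x r = 0} \<union> {x \<in> R. h x p = 0 \<and> h x r \<noteq> 0}"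
      by auto
    hence "card {x \<in> R. h x p = 0} = card {x \<in> R. h x p = 0 \<and> h x r = 0} + card {x \<in> R. h x p = 0 \<and> h x r \<noteq> 0}"
      by (subst card_Un_disjoint[symmetric]) auto
    moreover have "odd (card {x \<in> R. h x p = 0})" using card_point_perp_cases[OF p] by auto
    moreover have "odd (card {x \<in> R. h x p = 0 \<and> h x r = 0})"
      using odd_card_line_perp[OF p r(1) pr] False by blast
    ultimately have "even (card {x \<in> R. h x p = 0 \<and> h x r \<noteq> 0})" by presburger
    thus ?thesis by (simp add: kappa_self pr of_nat_parity)
  qed
qed

definition nontrivial :: "'a ^ 'm \<Rightarrow> bool" where
  "nontrivial p \<longleftrightarrow> p \<noteq> 0 \<and> h p p = 0 \<and> \<not> (\<exists>c\<in>{0,1}. \<forall>v. kappa p v v = c * h v v)"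

text \<open>This normalises \<open>kappa p\<close> modulo \<open>h\<close> so that it vanishes on a
  whole hyperplane, as \<open>no_common_form\<close> demands.\<close>

lemma kappa_reduced:
  assumes p: "p \<noteq> 0" "h p p = 0"
  shows "\<exists>c\<in>{0,1}. \<forall>v. h v p = 0 \<longrightarrow> kappa p v v + c * h v v = 0"
proof -
  obtain e f where H: "hyperbolic 3 e f" and e: "e 0 = p" using hyperbolic_point[of p] p by auto
  from vanish_on_perp[OF hform_kappa H, of p] kappa_perp[OF p] e
  show ?thesis by (metis add_self)
qed

lemma nontrivial_inequivalent:
  assumes p: "nontrivial p" and r: "nontrivial r" and pr: "h p r = 0" "\<And>c. r \<noteq> c *s p"
    and d: "d \<in> {0,1}" and eq: "\<And>v. kappa p v v = kappa r v v + d * h v v"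
  shows False
proof -
  have p': "p \<noteq> 0" "h p p = 0" and r': "r \<noteq> 0" "h r r = 0" using p r by (auto simp: nontrivial_def)
  obtain a where a: "a \<in> {0,1}" "\<And>v. h v p = 0 \<Longrightarrow> kappa p v v + a * h v v = 0"
    using kappa_reduced[OF p'] by blast
  obtain b where b: "b \<in> {0,1}" "\<And>v. h v r = 0 \<Longrightarrow> kappa r v v + b * h v v = 0"
    using kappa_reduced[OF r'] by blast
  show False
  proof (rule no_common_form[OF hform_add_scale[OF hform_kappa a(1)] hform_add_scale[OF hform_kappa b(1)] _ p' r'(2) pr a(2) b(2)])
    show "\<not> (\<forall>v. kappa p v v + a * h v v = 0)"
    proof
      assume z: "\<forall>v. kappa p v v + a * h v v = 0"
      have "kappa p v v = a * h v v" for v using z by (metis add.right_neutral add_self2 add.commute)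
      thus False using p a(1) by (auto simp: nontrivial_def)
    qed
    show "d + a + b \<in> {0,1}" using a(1) b(1) d zero_one_add[OF q4] by blast
    show "kappa p v v + a * h v v = kappa r v v + b * h v v + (d + a + b) * h v v" for v
      unfolding eq by (simp add: algebra_simps)
    show "kappa p x x + a * h x x = 0" if "x \<in> R" for x
      using kappa_R[OF p' that] R_isotropic[OF that] by simp
  qed
qed

text \<open>An isotropic vector is not orthogonal to \<open>33 - 1\<close> or \<open>33 - 9\<close>
  vectors of \<open>R\<close>, an even number.\<close>

lemma sum_form_R: "\<exists>c\<in>{0,1}. \<forall>v. sum_form R v v = c * h v v"
proof -
  have "sum_form R v v = 0" if v: "h v v = 0" for v
  proof (cases "v = 0")
    case False
    have "R = {x \<in> R. h x v = 0} \<union> {x \<in> R. h x v \<noteq> 0}" by auto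
    hence "card R = card {x \<in> R. h x v = 0} + card {x \<in> R. h x v \<noteq> 0}"
      by (subst card_Un_disjoint[symmetric]) auto
    hence "even (card {x \<in> R. h x v \<noteq> 0})" using card_R card_point_perp_cases[OF False v] by presburger
    thus ?thesis by (simp add: sum_form_self of_nat_parity)
  qed (simp add: sum_form_def)
  from vanish_on_isotropic[OF hform_sum_form this] show ?thesis by blast
qed

lemma sum_UNIV_f4:
  fixes g :: "'a \<Rightarrow> 'a"
  assumes "w * w = w + 1" "UNIV = {0, 1, w, w + 1}" "distinct [0, 1, w, w + 1]"
  shows "(\<Sum>c\<in>UNIV. g c) = g 0 + g 1 + g w + g (w + 1)"
  using assms(3) by (subst assms(2)) (simp add: add.assoc)

text \<open>The line has the five points \<open>p\<close> and \<open>r + d *s p\<close>. Each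
  \<open>x\<close> in \<open>R\<close> is orthogonal to one or all of them, hence to an odd number,
  and the five norm terms cancel.\<close>

lemma kappa_line_sum:
  "kappa p v v + (\<Sum>d\<in>UNIV. kappa (r + d *s p) v v) = sum_form R v v"
proof -
  obtain w :: 'a where w: "w * w = w + 1" "UNIV = {0, 1, w, w + 1}" "distinct [0, 1, w, w + 1]"
    using f4_omega[OF q4] by blast
  have "h v p * h p v + (\<Sum>d\<in>UNIV. h v (r + d *s p) * h (r + d *s p) v) = 0"
    unfolding sum_UNIV_f4[OF w] using w(1) by (simp add: power2_eq_square algebra_simps)
  moreover have "sum_form {x \<in> R. h x p = 0} v v + (\<Sum>d\<in>UNIV. sum_form {x \<in> R. h x (r + d *s p) = 0} v v)
    = sum_form R v v"
  proof -
    have eq: "sum_form {x \<in> R. Q x} v v = (\<Sum>x\<in>R. if Q x then h v x * h x v else 0)" for Q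
      unfolding sum_form_def by (rule sum.inter_filter) simp
    have "(if h x p = 0 then h v x * h x v else 0) + (\<Sum>d\<in>UNIV. if h x (r + d *s p) = 0 then h v x * h x v else 0)
      = h v x * h x v" for x
    proof (cases "h x p = 0")
      case True
      thus ?thesis by (simp add: q4)
    next
      case False
      have "h x (r + d *s p) = 0 \<longleftrightarrow> d = (h x r / h x p)\<^sup>2" for d
      proof
        assume "h x (r + d *s p) = 0"
        hence "h x r = - (d\<^sup>2 * h x p)" by (simp only: eq_neg_iff_add_eq_0) simp
        hence "d\<^sup>2 = h x r / h x p" using False by simp
        thus "d = (h x r / h x p)\<^sup>2" by (metis square_square)
      qed (use False in \<open>simp add: power_divide\<close>)
      thus ?thesis using False by simp
    qed
    thus ?thesis unfolding eq by (subst sum.swap) (simp add: sum.distrib[symmetric] sum_form_def)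
  qed
  ultimately show ?thesis unfolding kappa_def sum.distrib
    by (metis (no_types, lifting) add.assoc add.commute add.left_commute add_0)
qed

text \<open>With at most one further nontrivial point on the line, the line sum makes
  \<open>kappa p\<close> congruent modulo \<open>h\<close> to the form at that point or to 0; both
  are excluded.\<close>

lemma card_nontrivial_line:
  assumes p: "nontrivial p" and r: "h r r = 0" "h p r = 0" "\<And>c. r \<noteq> c *s p"
  shows "2 \<le> card {d. nontrivial (r + d *s p)}"
proof (rule ccontr)
  assume "\<not> ?thesis"
  hence "card {d. nontrivial (r + d *s p)} \<le> 1" by simp
  \<comment> \<open>\<open>d0\<close> is arbitrary if no \<open>r + d *s p\<close> is
    nontrivial.\<close>
  then obtain d0 where d0: "{d. nontrivial (r + d *s p)} \<subseteq> {d0}"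
    by (metis card_le_Suc0_iff_eq One_nat_def finite insertI1 subsetI empty_subsetI equals0I singletonD)
  have pp: "p \<noteq> 0" "h p p = 0" using p by (auto simp: nontrivial_def)
  have rp: "h r p = 0" using r(2) h_zero_sym by blast
  have ne: "r + d *s p \<noteq> c *s p" for d c
  proof
    assume "r + d *s p = c *s p"
    hence "r = (c + d) *s p" by (metis vector_sadd_rdistrib vminus(4) add.commute)
    thus False using r(3) by blast
  qed
  have iso: "r + d *s p \<noteq> 0" "h (r + d *s p) (r + d *s p) = 0" for d
    using ne[of d 0] r pp rp by auto
  have "\<forall>d. \<exists>c\<in>{0,1}. d \<noteq> d0 \<longrightarrow> (\<forall>v. kappa (r + d *s p) v v = c * h v v)"
    using d0 iso unfolding nontrivial_def by blast
  then obtain c where c: "\<And>d. c d \<in> {0,1}" "\<And>d v. d \<noteq> d0 \<Longrightarrow> kappa (r + d *s p) v v = c d * h v v"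
    by metis
  obtain s where s: "s \<in> {0,1}" "\<And>v. sum_form R v v = s * h v v" using sum_form_R by blast
  define t where "t = s + (\<Sum>d\<in>UNIV - {d0}. c d)"
  have "(\<Sum>d\<in>D. c d) \<in> {0,1}" for D
    by (induction D rule: infinite_finite_induct) (use c(1) zero_one_add[OF q4] in auto)
  hence t: "t \<in> {0,1}" unfolding t_def using s(1) zero_one_add[OF q4] by blast
  have eq: "kappa p v v = kappa (r + d0 *s p) v v + t * h v v" for v
  proof -
    have "(\<Sum>d\<in>UNIV. kappa (r + d *s p) v v) = kappa (r + d0 *s p) v v + (\<Sum>d\<in>UNIV - {d0}. c d * h v v)"
      by (subst sum.remove[of _ d0]) (auto simp: c(2))
    also have "(\<Sum>d\<in>UNIV - {d0}. c d * h v v) = (t + s) * h v v"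
      by (simp add: t_def sum_distrib_right[symmetric] algebra_simps)
    finally have "kappa p v v + (kappa (r + d0 *s p) v v + (t + s) * h v v) = s * h v v"
      using kappa_line_sum[of p v r] s(2) by simp
    hence "kappa p v v + (kappa p v v + (kappa (r + d0 *s p) v v + (t + s) * h v v)) = kappa p v v + s * h v v"
      by (rule arg_cong)
    hence "kappa (r + d0 *s p) v v + (t + s) * h v v + s * h v v = kappa p v v + s * h v v + s * h v v"
      by simp
    thus ?thesis by (simp add: algebra_simps)
  qed
  show False
  proof (cases "nontrivial (r + d0 *s p)")
    case True
    show False by (rule nontrivial_inequivalent[OF p True _ ne t eq]) (simp add: r pp)
  next
    case False
    then obtain b where b: "b \<in> {0,1}" "\<And>v. kappa (r + d0 *s p) v v = b * h v v"
      using iso[of d0] unfolding nontrivial_def by blast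
    have "kappa p v v = (b + t) * h v v" for v unfolding eq b(2) by (simp add: algebra_simps)
    moreover have "b + t \<in> {0,1}" using b(1) t zero_one_add[OF q4] by blast
    ultimately show False using p unfolding nontrivial_def by blast
  qed
qed

text \<open>Besides \<open>p\<close>, each of four lines through \<open>p\<close> in a generator
  plane carries at least two nontrivial points: \<open>1 + 4 * 2 = 9\<close>.\<close>

lemma nontrivial_plane:
  assumes p: "nontrivial p"
  shows "\<exists>Y. 9 \<le> card Y \<and> (\<forall>y\<in>Y. nontrivial y) \<and> (\<forall>y\<in>Y. \<forall>z\<in>Y. h y z = 0 \<and> (y \<noteq> z \<longrightarrow> (\<forall>c. z \<noteq> c *s y)))"
proof -
  have pp: "p \<noteq> 0" "h p p = 0" using p by (auto simp: nontrivial_def)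
  obtain e f where H: "hyperbolic 3 e f" and e: "e 0 = p" using hyperbolic_point[of p] pp by auto
  note D = hyperbolic3D[OF H, unfolded e]
  define g where "g = (\<lambda>(c, d). e 2 + c *s e 1 + d *s p)"
  define Z where "Z = (SIGMA c:UNIV. {d. nontrivial (g (c, d))})"
  \<comment> \<open>Pairing with the \<open>f i\<close> reads off the coordinates; the normalised
    first one shows that different parameters give nonproportional vectors.\<close>
  have co: "h (g cd) (f 2) = 1" "h (g cd) (f 1) = fst cd" "h (g cd) (f 0) = snd cd" for cd
    by (simp_all add: g_def D split: prod.split)
  have pf: "h p (f 2) = 0" using D by simp
  have gg: "h (g a) (g b) = 0" "h (g a) p = 0" "h p (g a) = 0" for a b
    by (simp_all add: g_def D split: prod.split)
  have gne: "g b \<noteq> c *s g a" if "a \<noteq> b" for a b c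
  proof
    assume eq: "g b = c *s g a"
    have "c = 1" using co(1)[of b] co(1)[of a] unfolding eq by simp
    thus False using that co(2,3)[of a] co(2,3)[of b] unfolding eq by (simp add: prod_eq_iff)
  qed
  have inj: "inj_on g Z"
  proof (rule inj_onI, rule ccontr)
    fix a b assume "g a = g b" "a \<noteq> b"
    thus False using gne[of a b 1] by simp
  qed
  have "card Z = (\<Sum>c\<in>UNIV. card {d. nontrivial (g (c, d))})" unfolding Z_def by (subst card_SigmaI) auto
  moreover have "2 \<le> card {d. nontrivial (g (c, d))}" for c
  proof -
    have "e 2 + c *s e 1 \<noteq> a *s p" for a
    proof
      assume "e 2 + c *s e 1 = a *s p"
      hence "h (e 2 + c *s e 1) (f 2) = h (a *s p) (f 2)" by simp
      thus False by (simp add: D)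
    qed
    thus ?thesis using card_nontrivial_line[OF p, of "e 2 + c *s e 1"] by (simp add: g_def D)
  qed
  hence "(\<Sum>c\<in>(UNIV::'a set). 2) \<le> (\<Sum>c\<in>UNIV. card {d. nontrivial (g (c, d))})" by (intro sum_mono)
  ultimately have Z8: "8 \<le> card Z" by (simp add: q4)
  have pg: "p \<noteq> c *s g a" "g a \<noteq> c *s p" for a c
  proof -
    show "g a \<noteq> c *s p"
    proof
      assume "g a = c *s p"
      thus False using co(1)[of a] pf by simp
    qed
    show "p \<noteq> c *s g a"
    proof
      assume eq: "p = c *s g a"
      have "c = 0" using pf unfolding eq using co(1)[of a] by simp
      thus False using eq pp by simp
    qed
  qed
  have "p \<notin> g ` Z" using pg(1)[of 1] by auto
  hence "card (insert p (g ` Z)) = Suc (card Z)" using inj by (simp add: card_image)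
  hence "9 \<le> card (insert p (g ` Z))" using Z8 by simp
  moreover have "\<forall>y\<in>insert p (g ` Z). nontrivial y" using p by (auto simp: Z_def)
  moreover have "h y z = 0 \<and> (y \<noteq> z \<longrightarrow> (\<forall>c. z \<noteq> c *s y))" if "y \<in> insert p (g ` Z)" "z \<in> insert p (g ` Z)" for y z
  proof -
    have "(y = p \<or> (\<exists>a. y = g a)) \<and> (z = p \<or> (\<exists>b. z = g b))" using that by blast
    thus ?thesis using gg pp(2) gne pg by metis
  qed
  ultimately show ?thesis by blast
qed

end

subsection \<open>Counting hermitian forms\<close>

lemma card_le_fibres:
  assumes "finite A" "\<And>y. card {x \<in> A. f x = y} \<le> k"
  shows "card A \<le> k * card (f ` A)"
proof -
  have "A = (\<Union>y\<in>f ` A. {x \<in> A. f x = y})" by auto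
  hence "card A \<le> (\<Sum>y\<in>f ` A. card {x \<in> A. f x = y})"
    using card_UN_le[of "f ` A" "\<lambda>y. {x \<in> A. f x = y}"] assms(1) by simp
  also have "\<dots> \<le> (\<Sum>y\<in>f ` A. k)" using assms(2) by (rule sum_mono)
  finally show ?thesis by (simp add: mult.commute)
qed

context hermitian_space
begin

definition hermitian_matrices :: "('a ^ 'm ^ 'm) set" where
  "hermitian_matrices = {g. \<forall>i j. g $ j $ i = (g $ i $ j)\<^sup>2}"

lemma hermitian_matricesD: "g \<in> hermitian_matrices \<Longrightarrow> (g $ i $ j)\<^sup>2 = g $ j $ i"
  unfolding hermitian_matrices_def mem_Collect_eq by (rule sym) blast

definition matrix_form :: "'a ^ 'm ^ 'm \<Rightarrow> 'a ^ 'm \<Rightarrow> 'a ^ 'm \<Rightarrow> 'a" where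
  "matrix_form g v w = (\<Sum>i\<in>UNIV. \<Sum>j\<in>UNIV. g $ i $ j * v $ i * (w $ j)\<^sup>2)"

text \<open>Every square matrix over \<open>GF(4)\<close> is uniquely of the form \<open>g + w g'\<close> with \<open>g\<close> and \<open>g'\<close> hermitian,
  where \<open>w\<close> is a primitive element.\<close>

lemma card_hermitian_matrices: "card hermitian_matrices = 2 ^ (CARD('m) * CARD('m))"
proof -
  obtain w :: 'a where w: "w * w = w + 1" using f4_omega[OF q4] by blast
  hence w2: "w\<^sup>2 = w + 1" by (simp add: power2_eq_square)
  have "bij_betw (\<lambda>(g, g'). \<chi> i j. g $ i $ j + w * g' $ i $ j)
     (hermitian_matrices \<times> hermitian_matrices) UNIV"
  \<comment> \<open>The conjugate transpose of \<open>M = g + w g'\<close> is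
    \<open>g + (w + 1) g'\<close>, so adding it to \<open>M\<close> recovers
    \<open>g'\<close>.\<close>
  proof (rule bij_betw_byWitness[where f' = "\<lambda>M. (\<chi> i j. M $ i $ j + w * (M $ i $ j + (M $ j $ i)\<^sup>2),
       \<chi> i j. M $ i $ j + (M $ j $ i)\<^sup>2)"])
    have sq: "(g $ j $ i)\<^sup>2 = g $ i $ j" if "g \<in> hermitian_matrices" for g i j
      using hermitian_matricesD[OF that] .
    have inv: "a + w * b + (c + w * d)\<^sup>2 = b" "a + w * b + w * b = a" if "c\<^sup>2 = a" "d\<^sup>2 = b" for a b c d
      using that(1) by (simp_all add: that(2) power_mult_distrib w2 algebra_simps)
    show "\<forall>a\<in>hermitian_matrices \<times> hermitian_matrices.
       (\<lambda>M. (\<chi> i j. M $ i $ j + w * (M $ i $ j + (M $ j $ i)\<^sup>2), \<chi> i j. M $ i $ j + (M $ j $ i)\<^sup>2))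
         ((\<lambda>(g, g'). \<chi> i j. g $ i $ j + w * g' $ i $ j) a) = a"
      by (auto simp only: mem_Times_iff split_def prod_eq_iff fst_conv snd_conv vec_eq_iff vec_lambda_beta inv[OF sq sq])
    have sym: "v + w * (v + u\<^sup>2) = (u + w * (u + v\<^sup>2))\<^sup>2" "v + u\<^sup>2 = (u + v\<^sup>2)\<^sup>2" for u v
      by (simp_all add: power_mult_distrib w2 algebra_simps)
    show "(\<lambda>M. (\<chi> i j. M $ i $ j + w * (M $ i $ j + (M $ j $ i)\<^sup>2), \<chi> i j. M $ i $ j + (M $ j $ i)\<^sup>2)) ` UNIV
        \<subseteq> hermitian_matrices \<times> hermitian_matrices"
      unfolding hermitian_matrices_def
      by (intro image_subsetI) (simp only: mem_Times_iff fst_conv snd_conv mem_Collect_eq vec_lambda_beta,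
        intro conjI allI sym)
    show "\<forall>M\<in>UNIV. (\<lambda>(g, g'). \<chi> i j. g $ i $ j + w * g' $ i $ j)
        ((\<chi> i j. M $ i $ j + w * (M $ i $ j + (M $ j $ i)\<^sup>2), \<chi> i j. M $ i $ j + (M $ j $ i)\<^sup>2)) = M"
      by (simp add: vec_eq_iff add.assoc)
  qed simp
  hence "card (hermitian_matrices \<times> hermitian_matrices) = CARD('a ^ 'm ^ 'm)"
    by (rule bij_betw_same_card)
  hence "card hermitian_matrices * card hermitian_matrices = (4::nat) ^ (CARD('m) * CARD('m))"
    by (simp add: card_cartesian_product q4 power_mult)
  also have "(4::nat) = 2 ^ 2" by simp
  finally have "(card hermitian_matrices)\<^sup>2 = (2 ^ (CARD('m) * CARD('m)))\<^sup>2"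
    by (simp only: power2_eq_square power_mult_distrib)
  thus ?thesis by (simp only: power2_eq_iff_nonneg)
qed

text \<open>The inverse map takes a form to its Gram matrix on the standard basis.\<close>

lemma bij_matrix_form: "bij_betw matrix_form hermitian_matrices {B. hform B}"
proof (rule bij_betw_byWitness[where f' = "\<lambda>B. \<chi> i j. B (axis i 1) (axis j 1)"])
  have ax: "(axis i (1::'a) :: 'a ^ 'm) $ j = (if j = i then 1 else 0)" for i j
    by (simp add: axis_def)
  have delta: "a * (if i = j then 1 else 0) = (if i = j then a else 0)"
     "(if P then 1 else 0)\<^sup>2 = (if P then 1 else (0::'a))" for a :: 'a and i j :: 'm and P
    by simp_all
  have "matrix_form g (axis i 1) (axis j 1) = g $ i $ j" for g i j
    unfolding matrix_form_def ax by (simp add: delta)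
  thus "\<forall>g\<in>hermitian_matrices. (\<chi> i j. matrix_form g (axis i 1) (axis j 1)) = g"
    by (simp add: vec_eq_iff)
  show "\<forall>B\<in>{B. hform B}. matrix_form (\<chi> i j. B (axis i 1) (axis j 1)) = B"
  proof (intro ballI ext)
    fix B v w assume "B \<in> {B. hform B}"
    hence B: "hform B" by simp
    have "B v w = B (\<Sum>i\<in>UNIV. v $ i *s axis i 1) (\<Sum>j\<in>UNIV. w $ j *s axis j 1)"
      by (simp only: basis_expansion)
    also have "\<dots> = matrix_form (\<chi> i j. B (axis i 1) (axis j 1)) v w"
      unfolding herm_sum(1)[OF B] unfolding herm_sum(2)[OF B]
      by (simp add: hermD(3,4)[OF B] matrix_form_def ac_simps)
    finally show "matrix_form (\<chi> i j. B (axis i 1) (axis j 1)) v w = B v w" by simp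
  qed
  show "matrix_form ` hermitian_matrices \<subseteq> {B. hform B}"
  proof safe
    fix g assume "g \<in> hermitian_matrices"
    hence g: "(g $ i $ j)\<^sup>2 = g $ j $ i" for i j by (rule hermitian_matricesD)
    have sq: "(\<Sum>x\<in>UNIV. k x)\<^sup>2 = (\<Sum>x\<in>UNIV. (k x)\<^sup>2)" for k :: "'m \<Rightarrow> 'a"
    proof -
      have "(\<Sum>x\<in>A. k x)\<^sup>2 = (\<Sum>x\<in>A. (k x)\<^sup>2)" for A
        by (induction A rule: infinite_finite_induct) auto
      thus ?thesis .
    qed
    have sym: "matrix_form g y x = (matrix_form g x y)\<^sup>2" for x y
      unfolding matrix_form_def sq power_mult_distrib g square_square
      by (subst sum.swap) (simp add: ac_simps)
    show "hform (matrix_form g)"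
      unfolding hermitian_form_def
      by (intro conjI allI sym)
        (simp_all add: matrix_form_def algebra_simps sum.distrib sum_distrib_left power_mult_distrib)
  qed
  show "(\<lambda>B. \<chi> i j. B (axis i 1) (axis j 1)) ` {B. hform B} \<subseteq> hermitian_matrices"
    unfolding hermitian_matrices_def using hermD(5) by auto
qed

lemma card_hform: "card {B. hform B} = 2 ^ (CARD('m) * CARD('m))" "finite {B. hform B}"
  using bij_betw_same_card[OF bij_matrix_form] card_hermitian_matrices
    bij_betw_finite[OF bij_matrix_form] by simp_all

end

section \<open>Forms vanishing on the ovoid and the final count\<close>

context ovoid6
begin

lemma card_hform6: "card {B. hform B} = 2 ^ 36"
  using card_hform(1) by (simp add: dim_eq)

text \<open>The values on \<open>R\<close> together with \<open>T\<close> are 34 additive bits on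
  \<open>2 ^ 36\<close> forms, so at least four forms have all bits zero; only two forms are
  multiples of \<open>h\<close>.\<close>

lemma ex_vanishing_form:
  assumes T: "\<And>B C. T (\<lambda>v w. B v w + C v w) = T B + T C" "\<And>B. hform B \<Longrightarrow> T B \<in> {0,1::'a}"
  shows "\<exists>B. hform B \<and> (\<forall>x\<in>R. B x x = 0) \<and> T B = 0 \<and> \<not> (\<exists>c\<in>{0,1}. \<forall>v w. B v w = c * h v w)"
proof (rule ccontr)
  assume no: "\<not> ?thesis"
  define \<Phi> where "\<Phi> = (\<lambda>B. ({x \<in> R. B x x \<noteq> 0}, T B))"
  have "card {B. hform B} \<le> 2 * card (\<Phi> ` {B. hform B})"
  proof (rule card_le_fibres)
    show "finite {B. hform B}" by (rule card_hform(2))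
    fix y
    show "card {B \<in> {B. hform B}. \<Phi> B = y} \<le> 2"
    proof (cases "{B \<in> {B. hform B}. \<Phi> B = y} = {}")
      case False
      then obtain B where B: "hform B" "\<Phi> B = y" by blast
      have "{B \<in> {B. hform B}. \<Phi> B = y} \<subseteq> {B, (\<lambda>v w. B v w + h v w)}"
      proof
        fix C assume "C \<in> {B \<in> {B. hform B}. \<Phi> B = y}"
        hence C: "hform C" "\<Phi> C = \<Phi> B" using B by auto
        define M where "M = (\<lambda>v w. B v w + C v w)"
        have M: "hform M" unfolding M_def by (rule hform_add[OF B(1) C(1)])
        have "M x x = 0" if "x \<in> R" for x
        proof -
          have "B x x \<noteq> 0 \<longleftrightarrow> C x x \<noteq> 0" using C(2) that unfolding \<Phi>_def by auto
          thus ?thesis using hform_self[OF B(1), of x] hform_self[OF C(1), of x] by (auto simp: M_def)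
        qed
        moreover have "T M = 0" using C(2) by (simp add: M_def T(1) \<Phi>_def)
        ultimately obtain c where c: "c \<in> {0,1}" "\<And>v w. M v w = c * h v w" using no M by blast
        have "C v w = B v w + c * h v w" for v w
          using c(2)[of v w] add_self2[of "B v w" "C v w"] by (simp add: M_def)
        hence "C = (\<lambda>v w. B v w + c * h v w)" by blast
        thus "C \<in> {B, (\<lambda>v w. B v w + h v w)}" using c(1) by auto
      qed
      hence "card {B \<in> {B. hform B}. \<Phi> B = y} \<le> card {B, (\<lambda>v w. B v w + h v w)}"
        by (intro card_mono) auto
      also have "\<dots> \<le> 2" by (simp add: card_insert_if)
      finally show ?thesis .
    qed (simp only: card.empty)
  qed
  also have "card (\<Phi> ` {B. hform B}) \<le> card (Pow R \<times> {0, 1::'a})"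
    by (rule card_mono) (use T(2) in \<open>auto simp: \<Phi>_def\<close>)
  hence "2 * card (\<Phi> ` {B. hform B}) \<le> 2 * card (Pow R \<times> {0, 1::'a})" by simp
  also have "card (Pow R \<times> {0, 1::'a}) = 2 ^ 34"
    by (simp add: card_cartesian_product card_Pow card_R)
  finally show False by (simp add: card_hform6)
qed

text \<open>By duality, an identity \<open>kappa p = c h\<close> gives the relation
  \<open>B(p,p) + \<Sum>\<^bsub>x \<in> R \<inter> p\<^sup>\<bottom>\<^esub> B(x,x) = c T(B)\<close> for every hermitian form \<open>B\<close>, where \<open>T\<close> is
  the trace with respect to \<open>h\<close>.\<close>

lemma ex_nontrivial: "\<exists>p. nontrivial p"
proof (rule ccontr)
  assume no: "\<not> ?thesis"
  obtain e f where H: "hyperbolic 3 e f" using ex_hyperbolic by blast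
  define b where "b = (\<lambda>i. if i < 3 then e i else f (i - 3))"
  define b' where "b' = (\<lambda>i. if i < 3 then f i else e (i - 3))"
  \<comment> \<open>This is the formula \<open>BB\<close> for \<open>B x x\<close> with the rank-one
    form of \<open>x\<close> replaced by \<open>h\<close>; \<open>b'\<close> is the basis dual to
    \<open>b\<close>.\<close>
  define T where "T = (\<lambda>B :: 'a^'m \<Rightarrow> 'a^'m \<Rightarrow> 'a. \<Sum>i<6. \<Sum>j<6. h (b' j) (b' i) * B (b i) (b j))"
  have six: "(\<Sum>i<6. g i) = g 0 + g 1 + g 2 + g 3 + g 4 + g 5" for g :: "nat \<Rightarrow> 'b::comm_monoid_add"
    by (simp add: eval_nat_numeral One_nat_def)
  have expand: "x = (\<Sum>i<6. h x (b' i) *s b i)" for x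
    unfolding six by (subst (1) expand3[OF H, of x]) (simp add: b_def b'_def One_nat_def)
  have BB: "B x x = (\<Sum>i<6. \<Sum>j<6. h (b' j) x * h x (b' i) * B (b i) (b j))" if B: "hform B" for B x
  proof -
    have "B x x = B (\<Sum>i<6. h x (b' i) *s b i) (\<Sum>j<6. h x (b' j) *s b j)"
      using expand[of x] by simp
    also have "\<dots> = (\<Sum>i<6. \<Sum>j<6. (h x (b' j))\<^sup>2 * (h x (b' i) * B (b i) (b j)))"
      unfolding herm_sum(1)[OF B] unfolding herm_sum(2)[OF B]
      by (simp add: hermD(3,4)[OF B] ac_simps)
    finally show ?thesis by (simp add: h_sym[symmetric] mult.assoc)
  qed
  have T1: "T B \<in> {0,1}" if B: "hform B" for B
  proof -
    note D = hyperbolic3D[OF H]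
    define a0 a1 a2 where a: "a0 = B (e 0) (f 0)" "a1 = B (e 1) (f 1)" "a2 = B (e 2) (f 2)"
    have "B (f 0) (e 0) = a0\<^sup>2" "B (f 1) (e 1) = a1\<^sup>2" "B (f 2) (e 2) = a2\<^sup>2"
      unfolding a by (rule hermD(5)[OF B])+
    hence "T B = (a0 + a0\<^sup>2) + (a1 + a1\<^sup>2) + (a2 + a2\<^sup>2)"
      unfolding T_def six by (simp add: b_def b'_def D a[symmetric] One_nat_def[symmetric])
    moreover have "s + s\<^sup>2 \<in> {0,1}" for s :: 'a
    proof -
      obtain w :: 'a where w: "w * w = w + 1" "UNIV = {0, 1, w, w + 1}"
        using f4_omega[OF q4] by blast
      have "s \<in> {0, 1, w, w + 1}" using w(2) by blast
      thus ?thesis using w(1) by (auto simp: power2_eq_square algebra_simps)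
    qed
    ultimately show ?thesis using zero_one_add[OF q4] by metis
  qed
  obtain B where B: "hform B" "\<And>x. x \<in> R \<Longrightarrow> B x x = 0" "T B = 0"
      "\<not> (\<exists>c\<in>{0,1}. \<forall>v w. B v w = c * h v w)"
    using ex_vanishing_form[of T, OF _ T1] by (auto simp: T_def sum.distrib algebra_simps)
  \<comment> \<open>Since \<open>B\<close> vanishes on \<open>R\<close> and \<open>T B = 0\<close>,
    duality applied to \<open>kappa p = c h\<close> leaves only \<open>B p p\<close>; then
    \<open>B\<close> vanishes on all isotropic vectors and would be a multiple of
    \<open>h\<close>.\<close>
  have "B p p = 0" if p: "h p p = 0" for p
  proof (cases "p = 0")
    case False
    then obtain c where c: "c \<in> {0,1}" "\<And>v. kappa p v v = c * h v v"
      using no p unfolding nontrivial_def by blast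
    have k: "kappa p v w = c * h v w" for v w
      by (rule hform_eqI[OF hform_kappa hform_scale[OF herm c(1)] c(2)])
    have "(\<Sum>x\<in>{x \<in> R. h x p = 0}. B x x) = (\<Sum>x\<in>{x \<in> R. h x p = 0}. \<Sum>i<6. \<Sum>j<6. h (b' j) x * h x (b' i) * B (b i) (b j))"
      using BB[OF B(1)] by simp
    also have "\<dots> = (\<Sum>i<6. \<Sum>j<6. sum_form {x \<in> R. h x p = 0} (b' j) (b' i) * B (b i) (b j))"
      unfolding sum_form_def sum_distrib_right
      by (subst sum.swap, rule sum.cong, rule refl, subst sum.swap) simp
    finally have "B p p + (\<Sum>x\<in>{x \<in> R. h x p = 0}. B x x)
        = (\<Sum>i<6. \<Sum>j<6. kappa p (b' j) (b' i) * B (b i) (b j))"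
      by (subst BB[OF B(1), of p]) (simp add: kappa_def sum.distrib[symmetric] algebra_simps)
    also have "\<dots> = c * T B" unfolding k T_def by (simp add: sum_distrib_left mult.assoc)
    finally show ?thesis using B(2,3) by simp
  qed (simp add: hermD(6)[OF B(1)])
  from vanish_on_isotropic[OF B(1) this] B(4) show False by blast
qed

text \<open>The map \<Psi> would inject at least \<open>9 * 2 * 2 ^ 32\<close> triples into the
  \<open>2 ^ 36\<close> hermitian forms.\<close>

lemma no_ovoid6: False
proof -
  obtain p where "nontrivial p" using ex_nontrivial by blast
  then obtain Y where Y': "9 \<le> card Y" "\<forall>y\<in>Y. nontrivial y"
     "\<forall>y\<in>Y. \<forall>z\<in>Y. h y z = 0 \<and> (y \<noteq> z \<longrightarrow> (\<forall>c. z \<noteq> c *s y))"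
    using nontrivial_plane by blast
  note Y = Y'(1) Y'(2)[rule_format] bspec[OF bspec[OF Y'(3)]]
  have "R \<noteq> {}" using card_R by auto
  then obtain x0 where x0: "x0 \<in> R" by blast
  define D where "D = Y \<times> ({0, 1::'a} \<times> Pow (R - {x0}))"
  define \<Psi> where "\<Psi> = (\<lambda>(y, c, S) v w. kappa y v w + c * h v w + sum_form S v w)"
  have "inj_on \<Psi> D"
  proof (rule inj_onI)
    fix s t assume st: "s \<in> D" "t \<in> D" "\<Psi> s = \<Psi> t"
    obtain y c S z d S' where s: "s = (y, c, S)" and t: "t = (z, d, S')" by (metis prod_cases3)
    have y: "nontrivial y" "nontrivial z" "y \<in> Y" "z \<in> Y" and cd: "c \<in> {0,1}" "d \<in> {0,1}"
      and S: "S \<subseteq> R - {x0}" "S' \<subseteq> R - {x0}" using st Y(2) by (auto simp: s t D_def)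
    have eq: "kappa y v v + c * h v v + sum_form S v v = kappa z v v + d * h v v + sum_form S' v v" for v
      using fun_cong[OF fun_cong[OF st(3), of v], of v] by (simp add: \<Psi>_def s t)
    \<comment> \<open>On \<open>R\<close> both the \<open>kappa\<close> terms and \<open>h\<close>
      vanish, so only the parity of the subset without \<open>x\<close> is visible.\<close>
    have par: "even (card (S - {x})) \<longleftrightarrow> even (card (S' - {x}))" if x: "x \<in> R" for x
    proof -
      have "{u \<in> W. h u x \<noteq> 0} = W - {x}" if "W \<subseteq> R" for W
        using that x R_not_orthogonal R_isotropic by blast
      hence "{u \<in> S. h u x \<noteq> 0} = S - {x}" "{u \<in> S'. h u x \<noteq> 0} = S' - {x}" using S by auto
      moreover have "kappa y x x = 0" "kappa z x x = 0" "h x x = 0"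
        using kappa_R x y R_isotropic by (auto simp: nontrivial_def)
      ultimately have "(of_nat (card (S - {x})) :: 'a) = of_nat (card (S' - {x}))"
        using eq[of x] by (simp add: sum_form_self)
      thus ?thesis by (auto simp: of_nat_parity split: if_splits)
    qed
    \<comment> \<open>As \<open>x0\<close> is excluded from the subsets, its value gives the parity
      of the whole subset, and the other values then decide membership.\<close>
    have par0: "even (card S) \<longleftrightarrow> even (card S')"
    proof -
      have "S - {x0} = S" "S' - {x0} = S'" using S by auto
      thus ?thesis using par[OF x0] by simp
    qed
    have cd': "even (card (W - {x})) \<longleftrightarrow> (even (card W) \<longleftrightarrow> x \<notin> W)" for W and x :: "'a ^ 'm"
    proof (cases "x \<in> W")
      case True
      hence "card W = Suc (card (W - {x}))" by (intro card.remove) simp_all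
      thus ?thesis using True by presburger
    qed simp
    have "x \<in> S \<longleftrightarrow> x \<in> S'" if "x \<in> R" for x using par[OF that] par0 by (auto simp: cd')
    hence SS: "S = S'" using S by blast
    have "kappa y v v = kappa z v v + (c + d) * h v v" for v
    proof -
      have "kappa y v v + c * h v v = kappa z v v + d * h v v" using eq[of v] SS by simp
      hence "kappa y v v + c * h v v + c * h v v = kappa z v v + d * h v v + c * h v v" by simp
      thus ?thesis by (simp add: algebra_simps)
    qed
    moreover have "c + d \<in> {0,1}" using cd zero_one_add[OF q4] by blast
    ultimately have yz: "y = z" using nontrivial_inequivalent[OF y(1,2)] Y(3)[OF y(3,4)] by blast
    obtain e f where "hyperbolic 3 e f" using ex_hyperbolic by blast
    \<comment> \<open>A vector of norm 1 separates \<open>c\<close> from \<open>d\<close>.\<close>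
    hence "\<exists>v. h v v = 1"
    proof -
      obtain w :: 'a where w: "w * w = w + 1" using f4_omega[OF q4] by blast
      assume "hyperbolic 3 e f"
      from hyperbolic3D[OF this] have "h (e 0 + w *s f 0) (e 0 + w *s f 0) = 1"
        using w by (simp add: power2_eq_square)
      thus ?thesis by blast
    qed
    then obtain v where "h v v = 1" ..
    hence "c = d" using eq[of v] by (simp add: yz SS)
    thus "s = t" by (simp add: s t yz SS)
  qed
  moreover have "\<Psi> ` D \<subseteq> {B. hform B}"
    unfolding \<Psi>_def D_def by (auto intro!: hform_add hform_add_scale hform_kappa hform_sum_form simp del: mult_1 mult_zero_left mult_1_left)
  ultimately have "card D \<le> card {B. hform B}" using card_hform(2) by (intro card_inj_on_le)
  moreover have "card D = card Y * (2 * 2 ^ 32)"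
    using x0 by (simp add: D_def card_cartesian_product card_Pow card_Diff_singleton card_R)
  ultimately show False using Y(1) by (simp add: card_hform6)
qed

end

subsection \<open>Reduction to rank three\<close>

context hermitian_space
begin

lemma point_eq_span:
  assumes "P \<in> points (polar_space h)" "v \<in> P" "v \<noteq> 0"
  shows "P = vec.span {v}"
proof -
  have P: "vec.subspace P" "vec.dim P = 1"
    using assms(1) by (auto simp: points_def polar_space_def totally_isotropic_def)
  have "vec.independent {v}" using assms(3) by simp
  hence "P \<subseteq> vec.span {v}" using assms(2) P(2) by (intro vec.card_ge_dim_independent) auto
  moreover have "vec.span {v} \<subseteq> P" using assms(2) P(1) by (intro vec.span_minimal) auto
  ultimately show ?thesis by blast
qed

lemma point_ex:
  assumes "P \<in> points (polar_space h)"
  obtains v where "v \<in> P" "v \<noteq> 0" "h v v = 0"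
proof -
  have P: "vec.subspace P" "P \<noteq> {0}" "\<And>x. x \<in> P \<Longrightarrow> h x x = 0"
    using assms by (auto simp: points_def polar_space_def totally_isotropic_def)
  then obtain v where "v \<in> P" "v \<noteq> 0" using vec.subspace_0[OF P(1)] by blast
  thus ?thesis using that P(3) by blast
qed

lemma ovoid_ex1:
  assumes O: "ovoid n (polar_space h) Ov" and n: "1 \<le> n" and H: "hyperbolic n e f"
  shows "\<exists>!P. P \<in> Ov \<and> P \<subseteq> vec.span (e ` {..<n})"
  using O hyperbolic_generator[OF H n] unfolding ovoid_def by blast

lemma hyperbolic_ovoid_point:
  assumes O: "ovoid n (polar_space h) Ov" and n: "1 \<le> n"
  shows "\<exists>e f. hyperbolic n e f \<and> (\<exists>P\<in>Ov. e 0 \<in> P)"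
proof -
  have "hyperbolic 0 e f" for e f by (simp add: hyperbolic_def)
  then obtain e f where "hyperbolic n e f" using hyperbolic_complete[of 0] by blast
  then obtain P where P: "P \<in> Ov" using ovoid_ex1[OF O n] by blast
  hence "P \<in> points (polar_space h)" using O by (auto simp: ovoid_def)
  then obtain v where v: "v \<in> P" "v \<noteq> 0" "h v v = 0" by (rule point_ex)
  from hyperbolic_point[OF v(2,3) n] obtain e f where "hyperbolic n e f" "e 0 = v" by blast
  thus ?thesis using P v(1) by blast
qed

end

text \<open>If \<open>e\<^sub>0\<close> spans a point of the ovoid then \<open>U = \<langle>e\<^sub>3, \<dots>, e\<^sub>n\<^sub>-\<^sub>1\<rangle>\<close> contains no point of the ovoid, so that
  the points of the ovoid in \<open>U\<^sup>\<bottom>\<close> induce an ovoid of the polar space \<open>U\<^sup>\<bottom>/U\<close> of rank three, which is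
  realised on the span of \<open>e\<^sub>0, e\<^sub>1, e\<^sub>2, f\<^sub>0, f\<^sub>1, f\<^sub>2\<close>.\<close>

lemma (in hermitian_space) ovoid_rank_three:
  assumes n: "3 \<le> n" and O: "ovoid n (polar_space h) Ov"
  shows "\<exists>(h' :: 'a ^ 6 \<Rightarrow> 'a ^ 6 \<Rightarrow> 'a) R. ovoid6 h' R"
proof -
  have n1: "1 \<le> n" using n by simp
  obtain e f P0 where H: "hyperbolic n e f" and P0: "P0 \<in> Ov" "e 0 \<in> P0"
    using hyperbolic_ovoid_point[OF O n1] by blast
  note D = hyperbolicD[OF H]
  have pts: "P \<in> points (polar_space h)" if "P \<in> Ov" for P using O that by (auto simp: ovoid_def)
  have e00: "e 0 \<noteq> 0" using D(3)[of 0 0] n by auto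
  have P0_span: "P0 = vec.span {e 0}" using point_eq_span[OF pts[OF P0(1)] P0(2) e00] .

  obtain \<phi> :: "6 \<Rightarrow> nat" where \<phi>: "bij_betw \<phi> UNIV {..<6}"
    using finite_same_card_bij[of "UNIV :: 6 set" "{..<6::nat}"] by auto
  have \<phi>6: "\<phi> k < 6" for k using \<phi> by (auto simp: bij_betw_def)
  have \<phi>inj: "\<phi> k = \<phi> l \<longleftrightarrow> k = l" for k l using \<phi> by (auto simp: bij_betw_def inj_def)
  have \<phi>ex: "\<exists>k. j = \<phi> k" if "j < 6" for j
  proof -
    have "j \<in> range \<phi>" using that bij_betw_imp_surj_on[OF \<phi>] by simp
    thus ?thesis by blast
  qed
  \<comment> \<open>\<open>b\<close> lists three hyperbolic pairs and \<open>b'\<close> the dual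
    vectors; \<phi> matches these indices with the index type \<open>6\<close>.\<close>
  define b where "b = (\<lambda>i. if i < 3 then e i else f (i - 3))"
  define b' where "b' = (\<lambda>i. if i < 3 then f i else e (i - 3))"
  have bb: "h (b i) (b' j) = (if i = j then 1 else 0)" if "i < 6" "j < 6" for i j
    using that n by (auto simp: b_def b'_def D)
  define \<iota> :: "'a ^ 6 \<Rightarrow> 'a ^ 'm" where "\<iota> = (\<lambda>x. \<Sum>k\<in>UNIV. x $ k *s b (\<phi> k))"
  have \<iota>_add: "\<iota> (x + y) = \<iota> x + \<iota> y" for x y
    by (simp add: \<iota>_def vector_sadd_rdistrib sum.distrib)
  have \<iota>_scale: "\<iota> (c *s x) = c *s \<iota> x" for c x
    by (simp add: \<iota>_def vec.scale_sum_right)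
  have \<iota>_coord: "h (\<iota> x) (b' (\<phi> k)) = x $ k" for x k
  proof -
    have "h (\<iota> x) (b' (\<phi> k)) = (\<Sum>l\<in>UNIV. x $ l * (if l = k then 1 else 0))"
      by (simp add: \<iota>_def herm_sum[OF herm] bb[OF \<phi>6 \<phi>6] \<phi>inj)
    also have "\<dots> = (\<Sum>l\<in>UNIV. if l = k then x $ l else 0)" by (rule sum.cong) auto
    finally show ?thesis by simp
  qed
  have \<iota>_0: "x = 0" if "\<iota> x = 0" for x
    using \<iota>_coord[of x] that by (simp add: vec_eq_iff)
  have perp: "h (\<iota> x) (e i) = 0" "h (e i) (\<iota> x) = 0" "h (\<iota> x) (f i) = 0" "h (f i) (\<iota> x) = 0"
    if "3 \<le> i" "i < n" for x i
  proof -
    have "h (b j) (e i) = 0" "h (b j) (f i) = 0" if "j < 6" for j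
      using that \<open>3 \<le> i\<close> \<open>i < n\<close> n by (auto simp: b_def D)
    thus "h (\<iota> x) (e i) = 0" "h (\<iota> x) (f i) = 0"
      using \<phi>6 by (simp_all add: \<iota>_def herm_sum[OF herm])
    thus "h (e i) (\<iota> x) = 0" "h (f i) (\<iota> x) = 0" using h_zero_sym by blast+
  qed
  \<comment> \<open>The span of the \<open>e i\<close> with \<open>3 \<le> i < n\<close>, described
    by the vanishing of all other coordinates.\<close>
  define U where "U = {u. (\<forall>i<n. h u (e i) = 0) \<and> (\<forall>i<3. h u (f i) = 0)}"
  have U_perp: "h u (\<iota> x) = 0" "h (\<iota> x) u = 0" if "u \<in> U" for u x
  proof -
    have "h u (b j) = 0" if "j < 6" for j
      using that \<open>u \<in> U\<close> n by (auto simp: b_def U_def)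
    thus "h u (\<iota> x) = 0" using \<phi>6 by (simp add: \<iota>_def herm_sum[OF herm])
    thus "h (\<iota> x) u = 0" using h_zero_sym by blast
  qed
  have U_iso: "h u u' = 0" if "u \<in> U" "u' \<in> U" for u u'
  proof -
    have "u' = (\<Sum>i<n. h u' (f i) *s e i)"
      using hyperbolic_expand[OF H, of u'] that by (simp add: U_def cong: sum.cong_simp)
    hence "h u u' = h u (\<Sum>i<n. h u' (f i) *s e i)" by simp
    also have "\<dots> = 0" using that by (simp add: herm_sum[OF herm] U_def)
    finally show ?thesis .
  qed
  have decomp: "\<exists>x u. v = \<iota> x + u \<and> u \<in> U" if v: "\<And>i. 3 \<le> i \<Longrightarrow> i < n \<Longrightarrow> h v (e i) = 0" for v
  proof -
    define x where "x = (\<chi> k. h v (b' (\<phi> k)))"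
    have c: "h (v + \<iota> x) (b' j) = 0" if j: "j < 6" for j
    proof -
      obtain k where "j = \<phi> k" using \<phi>ex[OF j] ..
      thus ?thesis by (simp add: \<iota>_coord x_def)
    qed
    have "v + \<iota> x \<in> U"
      unfolding U_def
    proof safe
      fix i assume i: "i < n"
      show "h (v + \<iota> x) (e i) = 0"
        using c[of "i + 3"] v[of i] perp(1)[of i x] i by (cases "i < 3") (auto simp: b'_def)
    next
      fix i :: nat assume "i < 3"
      thus "h (v + \<iota> x) (f i) = 0" using c[of i] by (simp add: b'_def)
    qed
    moreover have "v = \<iota> x + (v + \<iota> x)" by (simp add: ac_simps)
    ultimately show ?thesis by blast
  qed
  define h' where "h' = (\<lambda>x y. h (\<iota> x) (\<iota> y))"
  have h': "hermitian_form (\<lambda>x. x\<^sup>2) h'"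
    unfolding hermitian_form_def h'_def by (auto simp: \<iota>_add \<iota>_scale intro: h_sym)
  have nondeg': "nondegenerate h'"
    unfolding nondegenerate_def
  proof (intro allI impI)
    fix x assume x: "\<forall>y. h' x y = 0"
    have ax: "\<iota> (axis k 1) = b (\<phi> k)" for k
    proof -
      have "\<iota> (axis k 1) = (\<Sum>l\<in>UNIV. if l = k then b (\<phi> l) else 0)"
        unfolding \<iota>_def by (rule sum.cong) (auto simp: axis_def)
      thus ?thesis by simp
    qed
    have "x $ k = 0" for k
    proof -
      \<comment> \<open>Shifting the index by three exchanges \<open>e i\<close> and
        \<open>f i\<close>, so each dual vector is itself in the image of \<iota>.\<close>
      have "(if \<phi> k < 3 then \<phi> k + 3 else \<phi> k - 3) < 6" using \<phi>6[of k] by (split if_split) arith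
      from \<phi>ex[OF this] obtain l where l: "\<phi> l = (if \<phi> k < 3 then \<phi> k + 3 else \<phi> k - 3)" by metis
      have "b (\<phi> l) = b' (\<phi> k)"
      proof (cases "\<phi> k < 3")
        case False
        hence "\<phi> k - 3 < 3" using \<phi>6[of k] by arith
        with False l show ?thesis by (simp add: b_def b'_def)
      qed (simp add: l b_def b'_def)
      thus ?thesis using x[rule_format, of "axis l 1"] \<iota>_coord[of x k] by (simp add: h'_def ax)
    qed
    thus "x = 0" by (simp add: vec_eq_iff)
  qed
  interpret H': hermitian_space 3 h'
    by unfold_locales (use q4 h' nondeg' in simp_all)

  define Ov' where "Ov' = {P \<in> Ov. \<forall>v\<in>P. \<forall>i. 3 \<le> i \<longrightarrow> i < n \<longrightarrow> h v (e i) = 0}"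
  \<comment> \<open>A point of the ovoid inside \<open>U\<close> would share the generator of the
    \<open>e i\<close> with \<open>P0\<close>, hence equal \<open>P0\<close>; but \<open>e 0\<close>
    is not in \<open>U\<close>.\<close>
  have "\<exists>x u. x \<noteq> 0 \<and> u \<in> U \<and> \<iota> x + u \<in> P" if P: "P \<in> Ov'" for P
  proof -
    have PO: "P \<in> Ov" using P by (simp add: Ov'_def)
    obtain v where v: "v \<in> P" "v \<noteq> 0" "h v v = 0" using point_ex[OF pts[OF PO]] .
    obtain x u where xu: "v = \<iota> x + u" "u \<in> U"
      using decomp[of v] P v(1) by (auto simp: Ov'_def)
    have "x \<noteq> 0"
    proof
      assume "x = 0"
      hence vu: "v = u" using xu \<iota>_scale[of 0 0] by simp
      have "v \<in> vec.span (e ` {..<n})"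
        using xu(2) vu by (simp add: hyperbolic_span_iff[OF H] U_def)
      hence "P \<subseteq> vec.span (e ` {..<n})"
        unfolding point_eq_span[OF pts[OF PO] v(1,2)] by (intro vec.span_minimal) auto
      moreover have "P0 \<subseteq> vec.span (e ` {..<n})"
        unfolding P0_span using n by (intro vec.span_mono) auto
      ultimately have "P = P0" using ovoid_ex1[OF O n1 H] PO P0(1) by blast
      hence "e 0 \<in> vec.span {v}" using P0(2) point_eq_span[OF pts[OF PO] v(1,2)] by simp
      then obtain c where "e 0 = c *s v" by (auto simp: vec.span_singleton)
      hence "h (e 0) (f 0) = c * h v (f 0)" by simp
      thus False using xu(2) vu n D(3)[of 0 0] by (simp add: U_def)
    qed
    thus ?thesis using xu v(1) by blast
  qed
  then obtain \<rho> \<upsilon> where \<rho>: "\<And>P. P \<in> Ov' \<Longrightarrow> \<rho> P \<noteq> 0 \<and> \<upsilon> P \<in> U \<and> \<iota> (\<rho> P) + \<upsilon> P \<in> P"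
    by metis
  have \<rho>0: "\<iota> (\<rho> P) + \<upsilon> P \<noteq> 0" if P: "P \<in> Ov'" for P
  proof
    assume "\<iota> (\<rho> P) + \<upsilon> P = 0"
    hence "\<iota> (\<rho> P) = \<upsilon> P" by simp
    hence "h (\<iota> (\<rho> P)) (b' (\<phi> k)) = 0" for k
      using \<rho>[OF P] \<phi>6[of k] n by (auto simp: b'_def U_def)
    hence "\<rho> P = 0" by (simp add: \<iota>_coord vec_eq_iff)
    thus False using \<rho>[OF P] by simp
  qed
  have "ovoid6 h' (\<rho> ` Ov')"
  proof unfold_locales
    fix x assume "x \<in> \<rho> ` Ov'"
    then obtain P where P: "P \<in> Ov'" "x = \<rho> P" by blast
    have "\<forall>v\<in>P. \<forall>w\<in>P. h v w = 0"
      using pts[of P] P(1) by (simp add: Ov'_def points_def polar_space_def totally_isotropic_def)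
    hence "h (\<iota> x + \<upsilon> P) (\<iota> x + \<upsilon> P) = 0" using \<rho>[OF P(1)] P(2) by blast
    thus "x \<noteq> 0 \<and> h' x x = 0" using \<rho>[OF P(1)] U_perp U_iso P(2) by (simp add: h'_def)
  next
    fix E F assume EF: "H'.hyperbolic 3 E F"
    \<comment> \<open>Lifting a plane of the small space and adjoining the \<open>e i\<close> with
      \<open>3 \<le> i\<close> gives a generator containing \<open>U\<close>; its ovoid point
      automatically lies in the complement of \<open>U\<close>.\<close>
    define E' where "E' = (\<lambda>i. if i < 3 then \<iota> (E i) else e i)"
    define F' where "F' = (\<lambda>i. if i < 3 then \<iota> (F i) else f i)"
    have EF': "hyperbolic n E' F'"
      unfolding hyperbolic_def
    proof (intro allI impI)
      fix i j assume ij: "i < n" "j < n"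
      show "h (E' i) (E' j) = 0 \<and> h (F' i) (F' j) = 0 \<and> h (E' i) (F' j) = (if i = j then 1 else 0)"
        using ij D[OF ij] H'.hyperbolicD[OF EF, of i j] perp
        by (cases "i < 3"; cases "j < 3") (auto simp: E'_def F'_def h'_def)
    qed
    have key: "\<rho> P \<in> vec.span (E ` {..<3}) \<longleftrightarrow> P \<subseteq> vec.span (E' ` {..<n})" if P: "P \<in> Ov'" for P
    proof -
      let ?v = "\<iota> (\<rho> P) + \<upsilon> P"
      have PO: "P \<in> Ov" using P by (simp add: Ov'_def)
      have vP: "?v \<in> P" "\<upsilon> P \<in> U" using \<rho>[OF P] by auto
      have "P \<subseteq> vec.span (E' ` {..<n}) \<longleftrightarrow> ?v \<in> vec.span (E' ` {..<n})"
      proof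
        assume "?v \<in> vec.span (E' ` {..<n})"
        thus "P \<subseteq> vec.span (E' ` {..<n})"
          by (subst point_eq_span[OF pts[OF PO] vP(1) \<rho>0[OF P]]) (intro vec.span_minimal, auto)
      qed (use vP in blast)
      also have "\<dots> \<longleftrightarrow> (\<forall>i<n. h ?v (E' i) = 0)" by (rule hyperbolic_span_iff[OF EF'])
      also have "\<dots> \<longleftrightarrow> (\<forall>i<3. h' (\<rho> P) (E i) = 0)"
      proof -
        have "h ?v (E' i) = h' (\<rho> P) (E i)" if "i < 3" for i
          using that U_perp[OF vP(2)] by (simp add: E'_def h'_def)
        moreover have "h ?v (E' i) = 0" if "3 \<le> i" "i < n" for i
          using that P vP(1) by (auto simp: E'_def Ov'_def)
        ultimately show ?thesis using n by (metis le_trans not_less order_less_le_trans)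
      qed
      also have "\<dots> \<longleftrightarrow> \<rho> P \<in> vec.span (E ` {..<3})" by (rule H'.hyperbolic_span_iff[OF EF, symmetric])
      finally show ?thesis by blast
    qed
    have mem: "P \<in> Ov'" if P: "P \<in> Ov" "P \<subseteq> vec.span (E' ` {..<n})" for P
    proof -
      have "h v (e i) = 0" if "v \<in> P" "3 \<le> i" "i < n" for v i
      proof -
        have "h v (E' i) = 0" using that P(2) hyperbolic_span_iff[OF EF'] by blast
        thus ?thesis using that by (simp add: E'_def)
      qed
      thus ?thesis using P by (simp add: Ov'_def)
    qed
    obtain P where P: "P \<in> Ov" "P \<subseteq> vec.span (E' ` {..<n})"
      and uniq: "\<And>Q. Q \<in> Ov \<Longrightarrow> Q \<subseteq> vec.span (E' ` {..<n}) \<Longrightarrow> Q = P"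
      using ovoid_ex1[OF O n1 EF'] by blast
    show "\<exists>!x. x \<in> \<rho> ` Ov' \<and> x \<in> vec.span (E ` {..<3})"
    proof (rule ex1I[of _ "\<rho> P"])
      show "\<rho> P \<in> \<rho> ` Ov' \<and> \<rho> P \<in> vec.span (E ` {..<3})" using mem[OF P] key P by blast
      fix x assume "x \<in> \<rho> ` Ov' \<and> x \<in> vec.span (E ` {..<3})"
      then obtain Q where Q: "Q \<in> Ov'" "x = \<rho> Q" "\<rho> Q \<in> vec.span (E ` {..<3})" by blast
      have "Q \<in> Ov" using Q(1) by (simp add: Ov'_def)
      hence "Q = P" using uniq key[OF Q(1)] Q(3) by blast
      thus "x = \<rho> P" using Q(2) by simp
    qed
  qed
  thus ?thesis by blast
qed

theorem theorem5p4:
  fixes n :: nat and h :: "'a::{field,finite} ^ 'm::finite \<Rightarrow> 'a ^ 'm \<Rightarrow> 'a"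
  assumes "n \<ge> 3"
    and "CARD('a) = 4"
    and "CARD('m) = 2 * n"
    and "hermitian_form (\<lambda>x. x ^ 2) h"
    and "nondegenerate h"
  shows "\<not> (\<exists>\<O>. ovoid n (polar_space h) \<O>)"
proof
  interpret hermitian_space n h by unfold_locales fact+
  assume "\<exists>\<O>. ovoid n (polar_space h) \<O>"
  thus False using ovoid_rank_three[OF assms(1)] ovoid6.no_ovoid6 by blast
qed

end
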